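(* Let $b\in\omega^\omega$. Then the following inequalities hold (provably in ZFC). (i) Inequalities involving $\mathfrak b_b^{\mathsf{eq}}$ and $\mathfrak d_b^{\mathsf{eq}}$: $$\mathrm{add}(\mathcal M)\leq \mathfrak b_b^{\mathsf{eq}}\leq \mathrm{non}(\mathcal E)\quad\text{and}\quad \mathrm{cov}(\mathcal E)\leq \mathfrak d_b^{\mathsf{eq}}\leq \mathrm{cof}(\mathcal M).$$ (ii) The remaining inequalities of the diagram: $\aleph_1\leq\mathrm{add}(\mathcal N)\leq\mathrm{cov}(\mathcal N)\leq\mathrm{non}(\mathcal M)\leq\mathrm{cof}(\mathcal M)\leq\mathrm{cof}(\mathcal N)\leq\mathfrak c$; $\mathrm{add}(\mathcal N)\leq\mathrm{add}(\mathcal M)\leq\mathrm{cov}(\mathcal M)\leq\mathrm{non}(\mathcal N)\leq\mathrm{cof}(\mathcal N)$; $\mathrm{add}(\mathcal M)\leq\mathfrak b\leq\mathrm{non}(\mathcal M)$; $\mathrm{cov}(\mathcal M)\leq\mathfrak d\leq\mathrm{cof}(\mathcal M)$; $\mathfrak b\leq\mathfrak d$; $\mathrm{add}(\mathcal M)\leq\mathrm{non}(\mathcal E)$, $\mathrm{non}(\mathcal E)\leq\mathrm{non}(\mathcal M)$, $\mathrm{non}(\mathcal E)\leq\mathrm{non}(\mathcal N)$, $\mathrm{non}(\mathcal E)\leq\mathrm{cof}(\mathcal M)$; $\mathrm{add}(\mathcal M)\leq\mathrm{cov}(\mathcal E)$, $\mathrm{cov}(\mathcal M)\leq\mathrm{cov}(\mathcal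 E)$, $\mathrm{cov}(\mathcal N)\leq\mathrm{cov}(\mathcal E)$, $\mathrm{cov}(\mathcal E)\leq\mathrm{cof}(\mathcal M)$.
   Context: $\forall^\infty n$ means "for all but finitely many $n<\omega$". $\mathbb I$ is the set of partitions $I=\langle I_n : n<\omega\rangle$ of $\omega$ into finite non-empty intervals (enumerated increasingly). For $b\in\omega^\omega$, $\prod b=\prod_{n<\omega} b(n)$, where the number $b(n)$ is identified with the set $\{0,\dots,b(n)-1\}$. For $I\in\mathbb I$ and $f,h\in\prod b$, write $f\sqsubset^{\bullet}(I,h)$ iff $\forall^\infty n\ \exists k\in I_n:\ f(k)=h(k)$. Define $$\mathfrak b_b^{\mathsf{eq}}=\min\{|F| : F\subseteq\prod b,\ \neg\exists I\in\mathbb I\ \exists h\in\prod b\ \forall f\in F:\ f\sqsubset^{\bullet}(I,h)\},$$ $$\mathfrak d_b^{\mathsf{eq}}=\min\{|D| : D\subseteq\mathbb I\times\prod b,\ \forall f\in\prod b\ \exists (I,h)\in D:\ f\sqsubset^{\bullet}(I,h)\}.$$ For an ideal $\mathcal I$ of subsets of $X$ containing all singletons: $\mathrm{add}(\mathcal I)=\min\{|\mathcal J| : \mathcal J\subseteq\mathcal I,\ \bigcup\mathcal J\notin\mathcal I\}$; $\mathrm{cov}(\mathcal I)=\min\{|\mathcal J| : \mathcal J\subseteq\mathcal I,\ \bigcup\mathcal J=X\}$; $\mathrm{non}(\mathcal I)=\min\{|A| : A\subseteq X,\ A\notin\mathcal I\}$; $\mathrm{cof}(\mathcal I)=\min\{|\mathcal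 J| : \mathcal J\subseteq\mathcal I,\ \forall A\in\mathcal I\ \exists B\in\mathcal J:\ A\subseteq B\}$. $\mathcal M$, $\mathcal N$ and $\mathcal E$ denote, respectively, the ideal of meager sets, the ideal of Lebesgue measure zero sets, and the ideal generated by the $F_\sigma$ measure zero sets, on $2^\omega$ with the product of the uniform measures on $\{0,1\}$ (the cardinals do not change if one uses $\mathbb R$ with Lebesgue measure instead). $\mathfrak b$ and $\mathfrak d$ are the bounding and dominating numbers of $\langle\omega^\omega,\leq^*\rangle$, where $f\leq^* g$ iff $\forall^\infty n:\ f(n)\leq g(n)$: $\mathfrak b$ is the least size of a subset of $\omega^\omega$ with no $\leq^*$-upper bound, and $\mathfrak d$ is the least size of a $\leq^*$-cofinal subset of $\omega^\omega$. $\mathfrak c=2^{\aleph_0}$.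
   Formalization: All b(n) are assumed positive, and the two inequalities in (i) with E are stated only when Σ1/b(n) converges: with a zero value ∏b is empty and (i) fails; with b positive and Σ1/b(n) divergent those two fail in the random model (and for b=1, d_b^eq=1). *)

theory Defs
  imports "HOL-Probability.Probability"
begin

unbundle cardinal_syntax

text \<open>
  Cardinals are the well-order relations of the HOL cardinal theory: \<open>|A|\<close> is the cardinal of \<open>A\<close>
  and \<open>\<le>o\<close> compares cardinals living on possibly different types.

  \<open>min_card S\<close> is the least cardinality of a member of \<open>S\<close> (unique up to \<open>=o\<close>, see the lemmas below).
  When \<open>S\<close> is empty we use the top value \<open>|UNIV|\<close> among the cardinalities of sets over the
  type; below, this happens only for \<open>b_eq b\<close> with \<open>b n = 1\<close> for infinitely many \<open>n\<close>
  (and no \<open>b n = 0\<close>).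
\<close>

definition min_card :: "'a set set \<Rightarrow> 'a rel" where
  "min_card S =
     card_of (if S = {} then UNIV else SOME A. A \<in> S \<and> (\<forall>B\<in>S. |A| \<le>o |B| ))"

lemma ex_min_card:
  assumes "S \<noteq> {}"
  shows "\<exists>A\<in>S. \<forall>B\<in>S. |A| \<le>o |B|"
proof -
  have "\<exists>r\<in>card_of ` S. \<forall>r'\<in>card_of ` S. r \<le>o r'"
    by (rule exists_minim_Card_order) (use assms card_of_Card_order in auto)
  then show ?thesis by auto
qed

lemma min_card_attained:
  assumes "S \<noteq> {}"
  shows "\<exists>A\<in>S. min_card S = |A|"
  using someI_ex[of "\<lambda>A. A \<in> S \<and> (\<forall>B\<in>S. |A| \<le>o |B| )"] ex_min_card[OF assms] assms
  unfolding min_card_def by auto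

lemma min_card_le:
  assumes "A \<in> S"
  shows "min_card S \<le>o |A|"
  using someI_ex[of "\<lambda>A. A \<in> S \<and> (\<forall>B\<in>S. |A| \<le>o |B| )"] ex_min_card[of S] assms
  unfolding min_card_def by auto


definition add :: "'a set set \<Rightarrow> 'a set rel" where
  "add \<I> = min_card {\<J>. \<J> \<subseteq> \<I> \<and> \<Union>\<J> \<notin> \<I>}"

definition cov :: "'a set set \<Rightarrow> 'a set rel" where
  "cov \<I> = min_card {\<J>. \<J> \<subseteq> \<I> \<and> \<Union>\<J> = UNIV}"

definition non :: "'a set set \<Rightarrow> 'a rel" where
  "non \<I> = min_card {A. A \<notin> \<I>}"

definition cof :: "'a set set \<Rightarrow> 'a set rel" where
  "cof \<I> = min_card {\<J>. \<J> \<subseteq> \<I> \<and> (\<forall>A\<in>\<I>. \<exists>B\<in>\<J>. A \<subseteq> B)}"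


text \<open>
  The Cantor space is the type \<^typ>\<open>nat \<Rightarrow> bool\<close>; its type-class topology is the product of the
  discrete topology on \<^typ>\<open>bool\<close>.
\<close>

definition nowhere_dense :: "'a::topological_space set \<Rightarrow> bool" where
  "nowhere_dense A \<longleftrightarrow> interior (closure A) = {}"

definition meager :: "'a::topological_space set \<Rightarrow> bool" where
  "meager A \<longleftrightarrow> (\<exists>F :: nat \<Rightarrow> 'a set. (\<forall>n. nowhere_dense (F n)) \<and> A = (\<Union>n. F n))"

definition cantor_measure :: "(nat \<Rightarrow> bool) measure" where
  "cantor_measure = PiM UNIV (\<lambda>_. uniform_count_measure UNIV)"

definition generated_ideal :: "'a set set \<Rightarrow> 'a set set" where
  "generated_ideal G = {A. \<exists>H. finite H \<and> H \<subseteq> G \<and> A \<subseteq> \<Union>H}"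

definition ideal_M :: "(nat \<Rightarrow> bool) set set" where
  "ideal_M = {A. meager A}"

definition ideal_N :: "(nat \<Rightarrow> bool) set set" where
  "ideal_N = null_sets (completion cantor_measure)"

definition ideal_E :: "(nat \<Rightarrow> bool) set set" where
  "ideal_E = generated_ideal {A. fsigma A \<and> A \<in> ideal_N}"


definition le_star :: "(nat \<Rightarrow> nat) \<Rightarrow> (nat \<Rightarrow> nat) \<Rightarrow> bool" (infix "\<le>\<^sup>*" 50) where
  "f \<le>\<^sup>* g \<longleftrightarrow> (\<forall>\<^sub>\<infinity>n. f n \<le> g n)"

definition bounding_number :: "(nat \<Rightarrow> nat) rel" where
  "bounding_number = min_card {F. \<not> (\<exists>g. \<forall>f\<in>F. f \<le>\<^sup>* g)}"

definition dominating_number :: "(nat \<Rightarrow> nat) rel" where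
  "dominating_number = min_card {D. \<forall>f. \<exists>g\<in>D. f \<le>\<^sup>* g}"

definition aleph1 :: "nat set rel" where
  "aleph1 = cardSuc natLeq"

definition continuum :: "(nat \<Rightarrow> bool) rel" where
  "continuum = ctwo ^c natLeq"


definition interval_partitions :: "(nat \<Rightarrow> nat set) set" where
  "interval_partitions =
     {I. (\<forall>n. \<exists>l u. l \<le> u \<and> I n = {l..u}) \<and> (\<Union>n. I n) = UNIV \<and>
         (\<forall>m n. m < n \<longrightarrow> (\<forall>i\<in>I m. \<forall>j\<in>I n. i < j))}"

definition bprod :: "(nat \<Rightarrow> nat) \<Rightarrow> (nat \<Rightarrow> nat) set" where
  "bprod b = (\<Pi> n\<in>UNIV. {..<b n})"

definition meets :: "(nat \<Rightarrow> nat) \<Rightarrow> (nat \<Rightarrow> nat set) \<times> (nat \<Rightarrow> nat) \<Rightarrow> bool"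
    (infix "\<sqsubset>\<^sup>\<bullet>" 50) where
  "f \<sqsubset>\<^sup>\<bullet> Ih \<longleftrightarrow> (case Ih of (I, h) \<Rightarrow> \<forall>\<^sub>\<infinity>n. \<exists>k\<in>I n. f k = h k)"

text \<open>
  If \<open>bprod b = {}\<close> then \<open>b_eq b\<close> is \<open>0\<close>. If all \<open>b n\<close> are positive and \<open>\<Sum>n. 1 / b n\<close> converges,
  then for all \<open>I\<close> and \<open>h\<close> the set of \<open>f\<close> with \<open>f \<sqsubset>\<^sup>\<bullet> (I, h)\<close> is an F-sigma null set in \<open>bprod b\<close>;
  if the series diverges, then for suitable \<open>I\<close> and every \<open>h\<close> it has measure one.
\<close>

definition b_eq :: "(nat \<Rightarrow> nat) \<Rightarrow> (nat \<Rightarrow> nat) rel" where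
  "b_eq b = min_card {F. F \<subseteq> bprod b \<and>
     \<not> (\<exists>I\<in>interval_partitions. \<exists>h\<in>bprod b. \<forall>f\<in>F. f \<sqsubset>\<^sup>\<bullet> (I, h))}"

definition d_eq :: "(nat \<Rightarrow> nat) \<Rightarrow> ((nat \<Rightarrow> nat set) \<times> (nat \<Rightarrow> nat)) rel" where
  "d_eq b = min_card {D. D \<subseteq> interval_partitions \<times> bprod b \<and>
     (\<forall>f\<in>bprod b. \<exists>(I, h)\<in>D. f \<sqsubset>\<^sup>\<bullet> (I, h))}"

end

theory Submission
  imports Defs
begin

text \<open>
  Apart from \<open>aleph1\<close> and \<open>continuum\<close>, every cardinal of the diagram is the norm of a
  relational system: the least number of responses that together solve all challenges. The system of a pair
  (cofinality, additivity) is inclusion between members of the ideal, that of (covering number, uniformity) is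
  membership of points in members of the ideal, and the pairs of \<open>d_eq b\<close>, \<open>b_eq b\<close>
  and of \<open>dominating_number\<close>, \<open>bounding_number\<close> come from the relations
  \<open>\<sqsubset>\<^sup>\<bullet>\<close> and \<open>\<le>\<^sup>*\<close> themselves; the second cardinal of
  each pair is the norm of the dual system. A Tukey connection from one system to another yields an inequality
  between the norms and, dualized, an inequality between the dual norms (\<open>tukey_norm_le\<close>,
  \<open>tukey_dual\<close>), so nearly every connection below is used twice.

  On the category side all meager sets are replaced by those of the form \<open>avoid y a\<close>: the points that
  differ from \<open>y\<close> somewhere on almost all intervals \<open>[a n, a (n + 1))\<close>. They are cofinal among the
  meager sets (\<open>meager_subset_avoid\<close>), and inclusion between two of them has a purely combinatorial
  meaning (\<open>engulf\<close>): if \<open>avoid y a \<subseteq> avoid z c\<close>, then almost every interval of \<open>c\<close> contains an interval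
  of \<open>a\<close> on which \<open>y\<close> and \<open>z\<close> agree. Coding a function \<open>f\<close> in the lengths of the intervals shows that
  a meager superset of \<open>avoid y a\<close> computes a bound of \<open>f\<close> (\<open>tukey_dominating_meager\<close>). Coding \<open>f\<close> in
  \<open>y\<close>, one interval for each value in unary, shows that it computes an interval partition and a function
  that meets \<open>f\<close> on almost all intervals (\<open>tukey_meeting_meager\<close>); this gives the bounds of \<open>b_eq b\<close>
  and \<open>d_eq b\<close> by \<open>add ideal_M\<close> and \<open>cof ideal_M\<close>.

  If \<open>\<Sum>n. 1 / b n\<close> converges, map the Cantor space to \<open>bprod b\<close> by letting an initial segment of \<open>x\<close> of
  length about the binary logarithm of \<open>b n\<close> decide the \<open>n\<close>-th value. Each value is taken with
  probability at most \<open>2 / b n\<close>, so for given \<open>(I, h)\<close> the probability of meeting \<open>h\<close> on \<open>I n\<close> tends to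
  \<open>0\<close>, and the points that meet \<open>h\<close> on almost all intervals form an F-sigma null set
  (\<open>tukey_E_meeting\<close>). The function \<open>b n = 2 ^ n\<close> then also links \<open>add ideal_M\<close> to \<open>non ideal_E\<close> and
  \<open>cov ideal_E\<close> to \<open>cof ideal_M\<close>.

  The deepest part is Bartoszynski's theorem that additivity and cofinality of measure bound those
  of category. A null set determines finite sets \<open>S n\<close> of bounded size such that every function \<open>f\<close>
  whose associated null set \<open>null_code f\<close> it covers satisfies \<open>f n \<in> S n\<close> for almost all \<open>n\<close>
  (\<open>null_code_localization\<close>). Given \<open>avoid y a\<close>, one null set is used to bound the lengths of the
  intervals of \<open>a\<close>, and hence to fix windows each of which contains an interval of \<open>a\<close>. The windows
  are then grouped so that the \<open>n\<close>-th group has more members than \<open>S n\<close> has elements. A second null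
  set localizes the restrictions of \<open>y\<close> to the groups, and a single point \<open>z\<close> can copy each of the
  candidates on a window of its own. So \<open>avoid y a\<close> lies in a meager set that depends on the
  two null sets only (\<open>meager_null_two_step\<close>).
\<close>

section \<open>Relational systems and Tukey connections\<close>

text \<open>
  Relational systems in the sense of Vojtas: \<open>solves P x y\<close> says that the response \<open>y\<close> meets the
  challenge \<open>x\<close>.
\<close>

datatype ('a, 'b) relsys = Relsys (chal: "'a set") (resp: "'b set") (solves: "'a \<Rightarrow> 'b \<Rightarrow> bool")

definition solvable :: "('a, 'b) relsys \<Rightarrow> bool" where
  "solvable P \<longleftrightarrow> (\<forall>x\<in>chal P. \<exists>y\<in>resp P. solves P x y)"

definition norm_of :: "('a, 'b) relsys \<Rightarrow> 'b rel" where
  "norm_of P = min_card {D. D \<subseteq> resp P \<and> (\<forall>x\<in>chal P. \<exists>y\<in>D. solves P x y)}"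

text \<open>
  A challenge of the dual system is a response \<open>y\<close>; it is solved by any \<open>x\<close> that \<open>y\<close> fails to solve.
  Hence a set of responses that solves the dual system is a family of challenges of \<open>P\<close> without a
  common solution.
\<close>

definition dual :: "('a, 'b) relsys \<Rightarrow> ('b, 'a) relsys" where
  "dual P = Relsys (resp P) (chal P) (\<lambda>y x. \<not> solves P x y)"

text \<open>
  A generalized Galois-Tukey connection from \<open>P\<close> to \<open>Q\<close>.
\<close>

definition tukey :: "('a, 'b) relsys \<Rightarrow> ('c, 'd) relsys \<Rightarrow> bool" where
  "tukey P Q \<longleftrightarrow> (\<exists>\<phi>\<in>chal P \<rightarrow> chal Q. \<exists>\<psi>\<in>resp Q \<rightarrow> resp P.
     \<forall>x\<in>chal P. \<forall>y\<in>resp Q. solves Q (\<phi> x) y \<longrightarrow> solves P x (\<psi> y))"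

lemma dual_simps [simp]:
  "chal (dual P) = resp P" "resp (dual P) = chal P" "solves (dual P) y x \<longleftrightarrow> \<not> solves P x y"
  by (simp_all add: dual_def)

lemma dual_dual [simp]: "dual (dual P) = P"
  by (cases P) (simp add: dual_def)

lemma tukeyI:
  assumes "\<And>x. x \<in> chal P \<Longrightarrow> \<phi> x \<in> chal Q"
    and "\<And>y. y \<in> resp Q \<Longrightarrow> \<psi> y \<in> resp P"
    and "\<And>x y. \<lbrakk>x \<in> chal P; y \<in> resp Q; solves Q (\<phi> x) y\<rbrakk> \<Longrightarrow> solves P x (\<psi> y)"
  shows "tukey P Q"
  unfolding tukey_def using assms by (intro bexI[of _ \<phi>] bexI[of _ \<psi>]) auto

lemma tukey_dual: "tukey P Q \<Longrightarrow> tukey (dual Q) (dual P)"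
  unfolding tukey_def dual_simps by blast

lemma min_card_mono:
  assumes "T \<noteq> {}" and "\<And>B. B \<in> T \<Longrightarrow> \<exists>A\<in>S. |A| \<le>o |B|"
  shows "min_card S \<le>o min_card T"
proof -
  obtain B where B: "B \<in> T" "min_card T = |B|"
    using min_card_attained[OF assms(1)] by blast
  obtain A where "A \<in> S" "|A| \<le>o |B|" using assms(2)[OF B(1)] by blast
  then show ?thesis using min_card_le[of A S] B(2) by (metis ordLeq_transitive)
qed

lemma min_card_le_UNIV: "min_card (S :: 'a set set) \<le>o |UNIV :: 'a set|"
  unfolding min_card_def by (auto intro: card_of_mono1)

lemma norm_of_le:
  assumes "D \<subseteq> resp P" and "\<And>x. x \<in> chal P \<Longrightarrow> \<exists>y\<in>D. solves P x y"
  shows "norm_of P \<le>o |D|"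
  unfolding norm_of_def using assms by (intro min_card_le) auto

lemma norm_of_witness:
  assumes "solvable P"
  obtains D where "D \<subseteq> resp P" "\<And>x. x \<in> chal P \<Longrightarrow> \<exists>y\<in>D. solves P x y" "norm_of P = |D|"
proof -
  have "{D. D \<subseteq> resp P \<and> (\<forall>x\<in>chal P. \<exists>y\<in>D. solves P x y)} \<noteq> {}"
    using assms unfolding solvable_def by auto
  from min_card_attained[OF this] show ?thesis
    using that unfolding norm_of_def by auto
qed

text \<open>
  The images under \<open>\<psi>\<close> of a family that solves all of \<open>Q\<close> solve all of \<open>P\<close>. The challenges of \<open>Q\<close>
  have to be solvable, because the norm of a system that no family solves is only a default value.
\<close>

lemma tukey_norm_le:
  assumes "tukey P Q" "solvable Q"
  shows "norm_of P \<le>o norm_of Q"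
proof -
  obtain \<phi> \<psi> where \<phi>: "\<phi> \<in> chal P \<rightarrow> chal Q" and \<psi>: "\<psi> \<in> resp Q \<rightarrow> resp P"
    and *: "\<And>x y. \<lbrakk>x \<in> chal P; y \<in> resp Q; solves Q (\<phi> x) y\<rbrakk> \<Longrightarrow> solves P x (\<psi> y)"
    using assms(1) unfolding tukey_def by blast
  obtain D where D: "D \<subseteq> resp Q" "\<And>x. x \<in> chal Q \<Longrightarrow> \<exists>y\<in>D. solves Q x y" "norm_of Q = |D|"
    using norm_of_witness[OF assms(2)] by metis
  have "norm_of P \<le>o |\<psi> ` D|"
  proof (rule norm_of_le)
    show "\<psi> ` D \<subseteq> resp P" using D(1) \<psi> by auto
    fix x assume x: "x \<in> chal P"
    then obtain y where "y \<in> D" "solves Q (\<phi> x) y" using D(2)[of "\<phi> x"] \<phi> by auto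
    then show "\<exists>z\<in>\<psi> ` D. solves P x z" using * x D(1) by blast
  qed
  also have "|\<psi> ` D| \<le>o |D|" by (rule card_of_image)
  finally show ?thesis using D(3) by simp
qed

text \<open>
  A reduction in two rounds, where the second challenge may depend on the response to the first. For the
  dual norms one of the two rounds already gives an unsolved family; for the norms themselves a
  solving family \<open>D\<close> is replaced by \<open>D \<times> D\<close>, which has the same size if \<open>D\<close> is infinite.
\<close>

lemma tukey_two_step:
  fixes P :: "('a, 'b) relsys" and Q :: "('c, 'd) relsys"
  assumes \<phi>: "\<And>x. x \<in> chal P \<Longrightarrow> \<phi> x \<in> chal Q"
    and \<rho>: "\<And>x y. \<lbrakk>x \<in> chal P; y \<in> resp Q\<rbrakk> \<Longrightarrow> \<rho> y x \<in> chal Q"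
    and \<psi>: "\<And>y z. \<lbrakk>y \<in> resp Q; z \<in> resp Q\<rbrakk> \<Longrightarrow> \<psi> y z \<in> resp P"
    and *: "\<And>x y z. \<lbrakk>x \<in> chal P; y \<in> resp Q; z \<in> resp Q; solves Q (\<phi> x) y; solves Q (\<rho> y x) z\<rbrakk>
              \<Longrightarrow> solves P x (\<psi> y z)"
  shows "solvable (dual P) \<Longrightarrow> norm_of (dual Q) \<le>o norm_of (dual P)"
    and "\<lbrakk>solvable Q; \<And>D. \<lbrakk>D \<subseteq> resp Q; \<forall>x\<in>chal Q. \<exists>y\<in>D. solves Q x y\<rbrakk> \<Longrightarrow> infinite D\<rbrakk>
          \<Longrightarrow> norm_of P \<le>o norm_of Q"
proof -
  assume "solvable (dual P)"
  then obtain F where F: "F \<subseteq> chal P" "\<And>y. y \<in> resp P \<Longrightarrow> \<exists>x\<in>F. \<not> solves P x y"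
    "norm_of (dual P) = |F|"
    using norm_of_witness[of "dual P"] by auto
  \<comment> \<open>Either the first challenges have no common solution, or a common solution \<open>y\<close> exists and then
    the second challenges posed after \<open>y\<close> have none.\<close>
  show "norm_of (dual Q) \<le>o norm_of (dual P)"
  proof (cases "\<exists>y\<in>resp Q. \<forall>x\<in>F. solves Q (\<phi> x) y")
    case False
    have "norm_of (dual Q) \<le>o |\<phi> ` F|"
      by (rule norm_of_le) (use False F(1) \<phi> in auto)
    then show ?thesis using F(3) card_of_image ordLeq_transitive by metis
  next
    case True
    then obtain y where y: "y \<in> resp Q" "\<And>x. x \<in> F \<Longrightarrow> solves Q (\<phi> x) y" by blast
    have "norm_of (dual Q) \<le>o |\<rho> y ` F|"
    proof (rule norm_of_le)
      show "\<rho> y ` F \<subseteq> resp (dual Q)" using F(1) \<rho> y(1) by auto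
      fix z assume "z \<in> chal (dual Q)"
      then have z: "z \<in> resp Q" by simp
      obtain x where "x \<in> F" "\<not> solves P x (\<psi> y z)" using F(2) \<psi>[OF y(1) z] by blast
      then show "\<exists>u\<in>\<rho> y ` F. solves (dual Q) z u" using * y z F(1) by fastforce
    qed
    then show ?thesis using F(3) card_of_image ordLeq_transitive by metis
  qed
next
  assume "solvable Q"
    and inf: "\<And>D. \<lbrakk>D \<subseteq> resp Q; \<forall>x\<in>chal Q. \<exists>y\<in>D. solves Q x y\<rbrakk> \<Longrightarrow> infinite D"
  then obtain D where D: "D \<subseteq> resp Q" "\<And>x. x \<in> chal Q \<Longrightarrow> \<exists>y\<in>D. solves Q x y"
    "norm_of Q = |D|"
    by (metis norm_of_witness)
  have "norm_of P \<le>o |(\<lambda>(y, z). \<psi> y z) ` (D \<times> D)|"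
  proof (rule norm_of_le)
    show "(\<lambda>(y, z). \<psi> y z) ` (D \<times> D) \<subseteq> resp P" using \<psi> D(1) by auto
    fix x assume x: "x \<in> chal P"
    obtain y where y: "y \<in> D" "solves Q (\<phi> x) y" using D(2) \<phi> x by blast
    then obtain z where z: "z \<in> D" "solves Q (\<rho> y x) z" using D \<rho> x by blast
    have "solves P x (\<psi> y z)" using * x y z D(1) by blast
    then show "\<exists>w\<in>(\<lambda>(y, z). \<psi> y z) ` (D \<times> D). solves P x w" using y(1) z(1) by force
  qed
  also have "|(\<lambda>(y, z). \<psi> y z) ` (D \<times> D)| \<le>o |D \<times> D|" by (rule card_of_image)
  also have "|D \<times> D| \<le>o |D|"
    using card_of_Times_same_infinite[OF inf[OF D(1)]] D(2) by (simp add: ordIso_imp_ordLeq)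
  finally show "norm_of P \<le>o norm_of Q" using D(3) by simp
qed

definition inclusion_sys :: "'a set set \<Rightarrow> ('a set, 'a set) relsys" where
  "inclusion_sys \<I> = Relsys \<I> \<I> (\<subseteq>)"

definition membership_sys :: "'a set set \<Rightarrow> ('a, 'a set) relsys" where
  "membership_sys \<I> = Relsys UNIV \<I> (\<in>)"

definition dominating_sys :: "(nat \<Rightarrow> nat, nat \<Rightarrow> nat) relsys" where
  "dominating_sys = Relsys UNIV UNIV (\<le>\<^sup>*)"

definition meeting_sys ::
    "(nat \<Rightarrow> nat) \<Rightarrow> (nat \<Rightarrow> nat, (nat \<Rightarrow> nat set) \<times> (nat \<Rightarrow> nat)) relsys" where
  "meeting_sys b = Relsys (bprod b) (interval_partitions \<times> bprod b) (\<sqsubset>\<^sup>\<bullet>)"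

lemma sys_simps [simp]:
  "chal (inclusion_sys \<I>) = \<I>" "resp (inclusion_sys \<I>) = \<I>" "solves (inclusion_sys \<I>) = (\<subseteq>)"
  "chal (membership_sys \<I>) = UNIV" "resp (membership_sys \<I>) = \<I>" "solves (membership_sys \<I>) = (\<in>)"
  "chal dominating_sys = UNIV" "resp dominating_sys = UNIV" "solves dominating_sys = (\<le>\<^sup>*)"
  "chal (meeting_sys b) = bprod b" "resp (meeting_sys b) = interval_partitions \<times> bprod b"
  "solves (meeting_sys b) = (\<sqsubset>\<^sup>\<bullet>)"
  by (simp_all add: inclusion_sys_def membership_sys_def dominating_sys_def meeting_sys_def)

lemma cof_eq_norm: "cof \<I> = norm_of (inclusion_sys \<I>)"
  by (simp add: cof_def norm_of_def)

lemma add_eq_norm: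
  assumes "\<And>A B. \<lbrakk>B \<in> \<I>; A \<subseteq> B\<rbrakk> \<Longrightarrow> A \<in> \<I>"
  shows "add \<I> = norm_of (dual (inclusion_sys \<I>))"
proof -
  have "\<Union>\<J> \<notin> \<I> \<longleftrightarrow> (\<forall>B\<in>\<I>. \<exists>A\<in>\<J>. \<not> A \<subseteq> B)" for \<J>
    using assms by (metis Sup_least Union_upper)
  then show ?thesis by (simp add: add_def norm_of_def)
qed

lemma cov_eq_norm: "cov \<I> = norm_of (membership_sys \<I>)"
proof -
  have "\<Union>\<J> = UNIV \<longleftrightarrow> (\<forall>x. \<exists>B\<in>\<J>. x \<in> B)" for \<J> :: "'a set set" by auto
  then show ?thesis by (simp add: cov_def norm_of_def)
qed

lemma non_eq_norm:
  assumes "\<And>A B. \<lbrakk>B \<in> \<I>; A \<subseteq> B\<rbrakk> \<Longrightarrow> A \<in> \<I>"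
  shows "non \<I> = norm_of (dual (membership_sys \<I>))"
proof -
  have "A \<notin> \<I> \<longleftrightarrow> (\<forall>B\<in>\<I>. \<exists>x\<in>A. x \<notin> B)" for A
    using assms by (metis subsetI)
  then show ?thesis by (simp add: non_def norm_of_def)
qed

lemma dominating_eq_norm: "dominating_number = norm_of dominating_sys"
  by (simp add: dominating_number_def norm_of_def)

lemma bounding_eq_norm: "bounding_number = norm_of (dual dominating_sys)"
  by (simp add: bounding_number_def norm_of_def)

lemma d_eq_eq_norm: "d_eq b = norm_of (meeting_sys b)"
  by (simp add: d_eq_def norm_of_def case_prod_unfold)

lemma b_eq_eq_norm: "b_eq b = norm_of (dual (meeting_sys b))"
  unfolding b_eq_def norm_of_def by (rule arg_cong[where f = min_card]) auto

text \<open>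
  A bound of a dominating family could not be dominated after adding one everywhere.
\<close>

lemma bounding_le_dominating: "bounding_number \<le>o dominating_number"
  unfolding bounding_number_def dominating_number_def
proof (rule min_card_mono)
  show "{D. \<forall>f. \<exists>g\<in>D. f \<le>\<^sup>* g} \<noteq> {}"
  proof -
    have "f \<le>\<^sup>* f" for f by (simp add: le_star_def)
    then show ?thesis by blast
  qed
  fix D assume "D \<in> {D. \<forall>f. \<exists>g\<in>D. f \<le>\<^sup>* g}"
  then have D: "\<exists>g\<in>D. f \<le>\<^sup>* g" for f by blast
  have "\<not> (\<forall>f\<in>D. f \<le>\<^sup>* g)" for g
  proof
    assume g: "\<forall>f\<in>D. f \<le>\<^sup>* g"
    obtain d where "d \<in> D" "(\<lambda>n. Suc (g n)) \<le>\<^sup>* d" using D by blast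
    with g have "\<forall>\<^sub>\<infinity>n. Suc (g n) \<le> d n" "\<forall>\<^sub>\<infinity>n. d n \<le> g n" by (auto simp: le_star_def)
    then have "\<forall>\<^sub>\<infinity>n::nat. False" by eventually_elim simp
    then show False by (simp add: MOST_neq)
  qed
  then show "\<exists>A\<in>{F. \<not> (\<exists>g. \<forall>f\<in>F. f \<le>\<^sup>* g)}. |A| \<le>o |D|" by (auto intro!: exI[of _ D] card_of_mono1)
qed

section \<open>Category in the Cantor space\<close>

definition cyl :: "bool list \<Rightarrow> (nat \<Rightarrow> bool) set" where
  "cyl s = {z. \<forall>i<length s. z i = s ! i}"

abbreviation pre :: "(nat \<Rightarrow> bool) \<Rightarrow> nat \<Rightarrow> bool list" where
  "pre x m \<equiv> map x [0..<m]"

lemma in_cyl_pre [simp]: "z \<in> cyl (pre x m) \<longleftrightarrow> (\<forall>i<m. z i = x i)"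
  by (auto simp: cyl_def)

lemma open_cyl: "open (cyl s)"
proof -
  have "open {f. \<forall>i\<in>{..<length s}. (f :: nat \<Rightarrow> bool) i \<in> {s ! i}}"
    by (rule product_topology_basis') (simp, rule Topological_Spaces.open_discrete)
  then show ?thesis by (simp add: cyl_def Ball_def)
qed

lemma closed_cyl: "closed (cyl s)"
proof -
  have "- cyl s = (\<Union>x\<in>- cyl s. cyl (pre x (length s)))"
    by (auto simp: cyl_def)
  then show ?thesis unfolding closed_def by (metis open_UN open_cyl)
qed

lemma open_contains_cyl:
  assumes "open U" "x \<in> U"
  obtains m where "cyl (pre x m) \<subseteq> U"
proof -
  have "openin (product_topology (\<lambda>i::nat. euclidean :: bool topology) UNIV) U"
    using assms(1) by (simp add: open_fun_def)
  from product_topology_open_contains_basis[OF this assms(2)]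
  obtain X where X: "x \<in> (\<Pi>\<^sub>E i\<in>UNIV. X i)" "finite {i. X i \<noteq> UNIV}" "(\<Pi>\<^sub>E i\<in>UNIV. X i) \<subseteq> U"
    unfolding topspace_euclidean by metis
  have "\<exists>m. \<forall>i\<in>{i. X i \<noteq> UNIV}. i < m"
    using X(2) by (simp only: finite_nat_set_iff_bounded)
  then obtain m where m: "\<forall>i\<in>{i. X i \<noteq> UNIV}. i < m" ..
  have "cyl (pre x m) \<subseteq> (\<Pi>\<^sub>E i\<in>UNIV. X i)"
  proof
    fix z assume z: "z \<in> cyl (pre x m)"
    have "z i \<in> X i" for i
    proof (cases "i < m")
      case True
      then have "z i = x i" using z by simp
      then show ?thesis using PiE_mem[OF X(1), of i] by simp
    next
      case False
      then have "X i = UNIV" using m by blast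
      then show ?thesis by simp
    qed
    then show "z \<in> (\<Pi>\<^sub>E i\<in>UNIV. X i)" by (simp add: PiE_UNIV_domain)
  qed
  also note X(3)
  finally show ?thesis by (rule that)
qed

lemma nowhere_dense_iff_cyl:
  "nowhere_dense A \<longleftrightarrow>
    (\<forall>x m. \<exists>y m'. m \<le> m' \<and> y \<in> cyl (pre x m) \<and> cyl (pre y m') \<inter> A = {})" (is "?L \<longleftrightarrow> ?R")
proof
  assume nd: ?L
  show ?R
  proof (intro allI)
    fix x m
    have "\<not> cyl (pre x m) \<subseteq> closure A"
    proof
      assume "cyl (pre x m) \<subseteq> closure A"
      then have "cyl (pre x m) \<subseteq> interior (closure A)" by (rule interior_maximal) (rule open_cyl)
      then have "x \<in> interior (closure A)" by auto
      then show False using nd by (simp add: nowhere_dense_def)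
    qed
    then obtain y where y: "y \<in> cyl (pre x m)" "y \<in> - closure A" by blast
    obtain k where k: "cyl (pre y k) \<subseteq> - closure A"
      using open_contains_cyl[OF _ y(2)] by blast
    have "cyl (pre y (max m k)) \<subseteq> cyl (pre y k)" by (simp add: subset_iff)
    then have "cyl (pre y (max m k)) \<inter> A = {}"
      using k closure_subset[of A] by blast
    then show "\<exists>y m'. m \<le> m' \<and> y \<in> cyl (pre x m) \<and> cyl (pre y m') \<inter> A = {}"
      using y(1) by (intro exI[of _ y] exI[of _ "max m k"]) simp
  qed
next
  assume R: ?R
  have False if x: "x \<in> interior (closure A)" for x
  proof -
    obtain m where m: "cyl (pre x m) \<subseteq> interior (closure A)"
      using open_contains_cyl[OF open_interior x] .
    obtain y m' where y: "y \<in> cyl (pre x m)" "cyl (pre y m') \<inter> A = {}" using R by metis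
    have "cyl (pre y m') \<inter> closure A = {}"
      using y(2) open_Int_closure_eq_empty[OF open_cyl] by blast
    moreover have "y \<in> cyl (pre y m') \<inter> closure A"
      using y(1) subset_trans[OF m interior_subset] by auto
    ultimately show False by blast
  qed
  then show ?L by (auto simp: nowhere_dense_def)
qed

lemma nowhere_denseD:
  assumes "nowhere_dense A"
  shows "\<exists>y m'. m \<le> m' \<and> (\<forall>i<m. y i = x i) \<and> cyl (pre y m') \<inter> A = {}"
  using assms nowhere_dense_iff_cyl[of A] by simp

lemma nowhere_dense_Un:
  fixes A B :: "(nat \<Rightarrow> bool) set"
  assumes "nowhere_dense A" "nowhere_dense B"
  shows "nowhere_dense (A \<union> B)"
  unfolding nowhere_dense_iff_cyl
proof (intro allI)
  fix x m
  obtain y k where y: "m \<le> k" "y \<in> cyl (pre x m)" "cyl (pre y k) \<inter> A = {}"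
    using nowhere_denseD[OF assms(1), of m x] by auto
  obtain z l where z: "k \<le> l" "z \<in> cyl (pre y k)" "cyl (pre z l) \<inter> B = {}"
    using nowhere_denseD[OF assms(2), of k y] by auto
  have "cyl (pre z l) \<subseteq> cyl (pre y k)" using z(1,2) by auto
  then have "cyl (pre z l) \<inter> (A \<union> B) = {}" using y(3) z(3) by blast
  moreover have "z \<in> cyl (pre x m)" using y(1,2) z(2) by auto
  ultimately show "\<exists>y m'. m \<le> m' \<and> y \<in> cyl (pre x m) \<and> cyl (pre y m') \<inter> (A \<union> B) = {}"
    using y(1) z(1) order_trans by blast
qed

lemma nowhere_dense_UN_atMost:
  fixes F :: "nat \<Rightarrow> (nat \<Rightarrow> bool) set"
  assumes "\<And>n. nowhere_dense (F n)"
  shows "nowhere_dense (\<Union>k\<le>n. F k)"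
proof (induction n)
  case (Suc n)
  then show ?case using assms nowhere_dense_Un by (simp add: atMost_Suc)
qed (use assms in simp)

lemma nowhere_dense_subset:
  assumes "nowhere_dense B" "A \<subseteq> B"
  shows "nowhere_dense A"
  using assms interior_mono[OF closure_mono[OF assms(2)]] by (simp add: nowhere_dense_def)

lemma meagerI:
  assumes "\<And>n :: nat. nowhere_dense (F n)" "A \<subseteq> (\<Union>n. F n)"
  shows "meager A"
  unfolding meager_def
proof (intro exI[of _ "\<lambda>n. F n \<inter> A"] conjI allI)
  fix n show "nowhere_dense (F n \<inter> A)"
    by (rule nowhere_dense_subset[OF assms(1)]) auto
qed (use assms(2) in auto)

lemma meager_subset: "\<lbrakk>meager B; A \<subseteq> B\<rbrakk> \<Longrightarrow> meager A"
  unfolding meager_def[of B] using meagerI by blast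

lemma meager_Un:
  fixes A B :: "(nat \<Rightarrow> bool) set"
  assumes "meager A" "meager B"
  shows "meager (A \<union> B)"
proof -
  obtain F G :: "nat \<Rightarrow> (nat \<Rightarrow> bool) set" where
    F: "\<And>n. nowhere_dense (F n)" "A = (\<Union>n. F n)" and G: "\<And>n. nowhere_dense (G n)" "B = (\<Union>n. G n)"
    using assms unfolding meager_def by metis
  show ?thesis
    by (rule meagerI[of "\<lambda>n. F n \<union> G n"]) (use F G nowhere_dense_Un in auto)
qed

text \<open>
  The intervals \<open>[a n, a (n + 1))\<close> are disjoint, so values can be prescribed on them independently.
\<close>

lemma strict_mono_glue:
  fixes a :: "nat \<Rightarrow> nat" and Y :: "nat \<Rightarrow> nat \<Rightarrow> 'a"
  assumes "strict_mono a"
  obtains z where "\<And>n i. \<lbrakk>a n \<le> i; i < a (Suc n)\<rbrakk> \<Longrightarrow> z i = Y n i"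
proof
  fix n i assume i: "a n \<le> i" "i < a (Suc n)"
  have "(LEAST k. i < a (Suc k)) = n"
  proof (rule Least_equality)
    fix k assume "i < a (Suc k)"
    then have "a n < a (Suc k)" using i by simp
    then show "n \<le> k" using strict_mono_less[OF assms] by (simp add: less_Suc_eq_le)
  qed (rule i)
  then show "Y (LEAST k. i < a (Suc k)) i = Y n i" by simp
qed

text \<open>
  The combinatorial form of a meager set. Its complement consists of the points that match \<open>y\<close> on
  infinitely many intervals.
\<close>

definition avoid :: "(nat \<Rightarrow> bool) \<Rightarrow> (nat \<Rightarrow> nat) \<Rightarrow> (nat \<Rightarrow> bool) set" where
  "avoid y a = {x. \<forall>\<^sub>\<infinity>n. \<exists>i\<in>{a n..<a (Suc n)}. x i \<noteq> y i}"

lemma not_in_avoid: "x \<notin> avoid y a \<longleftrightarrow> (\<exists>\<^sub>\<infinity>n. \<forall>i\<in>{a n..<a (Suc n)}. x i = y i)"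
  by (simp add: avoid_def)

text \<open>
  Each of the countably many pieces is nowhere dense, since a finite condition can be extended by
  copying \<open>y\<close> on a later interval.
\<close>

lemma meager_avoid:
  assumes "strict_mono a"
  shows "meager (avoid y a)"
proof (rule meagerI)
  define F where "F m = {x. \<forall>n\<ge>m. \<exists>i\<in>{a n..<a (Suc n)}. x i \<noteq> y i}" for m
  show "avoid y a \<subseteq> (\<Union>m. F m)"
    by (auto simp: avoid_def F_def MOST_nat_le)
  fix m show "nowhere_dense (F m)"
    unfolding nowhere_dense_iff_cyl
  proof (intro allI)
    fix x M
    define n where "n = max m M"
    define w where "w i = (if i < a n then x i else y i)" for i
    have "M \<le> a n" using strict_mono_imp_increasing[OF assms, of n] by (simp add: n_def)
    moreover have "a n < a (Suc n)" using assms by (simp add: strict_monoD)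
    moreover have "cyl (pre w (a (Suc n))) \<inter> F m = {}"
    proof -
      have "z \<notin> F m" if "\<forall>i<a (Suc n). z i = w i" for z
      proof
        assume "z \<in> F m"
        moreover have "m \<le> n" by (simp add: n_def)
        ultimately obtain i where "i \<in> {a n..<a (Suc n)}" "z i \<noteq> y i"
          unfolding F_def by blast
        then show False using that by (auto simp: w_def)
      qed
      then show ?thesis by (simp add: disjoint_iff)
    qed
    ultimately show "\<exists>y m'. M \<le> m' \<and> y \<in> cyl (pre x M) \<and> cyl (pre y m') \<inter> F m = {}"
      by (intro exI[of _ w] exI[of _ "a (Suc n)"]) (auto simp: w_def)
  qed
qed

text \<open>
  One block of values keeps a point out of \<open>E\<close> whatever its initial segment of length \<open>m\<close> is: there are
  only finitely many initial segments, and the block can be prolonged for one after the other.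
\<close>

lemma nowhere_dense_avoiding_block:
  fixes E :: "(nat \<Rightarrow> bool) set"
  assumes E: "nowhere_dense E"
  obtains m' :: nat and y where "m < m'" "\<And>z. (\<forall>i\<in>{m..<m'}. z i = y i) \<Longrightarrow> z \<notin> E"
proof -
  \<comment> \<open>Representatives of the initial segments of length \<open>m\<close>.\<close>
  define T where "T = {t :: nat \<Rightarrow> bool. \<forall>i\<ge>m. \<not> t i}"
  have "finite T"
  proof -
    have "T \<subseteq> (\<lambda>A i. i \<in> A) ` Pow {..<m}"
    proof
      fix t assume "t \<in> T"
      then have "{i. t i} \<in> Pow {..<m}" by (auto simp: T_def not_le[symmetric])
      moreover have "t = (\<lambda>i. i \<in> {i. t i})" by simp
      ultimately show "t \<in> (\<lambda>A i. i \<in> A) ` Pow {..<m}" by blast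
    qed
    then show ?thesis by (rule finite_subset) simp
  qed
  have "\<exists>m' y. m < m' \<and> (\<forall>z. (\<exists>t\<in>S. \<forall>i<m. z i = t i) \<longrightarrow> (\<forall>i\<in>{m..<m'}. z i = y i) \<longrightarrow> z \<notin> E)"
    if "finite S" for S :: "(nat \<Rightarrow> bool) set"
    using that
  proof (induction S)
    case empty
    then show ?case by (intro exI[of _ "Suc m"]) simp
  next
    case (insert t S)
    then obtain k y where k: "m < k"
      "\<And>z. \<lbrakk>\<exists>t\<in>S. \<forall>i<m. z i = t i; \<forall>i\<in>{m..<k}. z i = y i\<rbrakk> \<Longrightarrow> z \<notin> E" by metis
    obtain w l where w: "k \<le> l" "\<forall>i<k. w i = (if i < m then t i else y i)"
      "cyl (pre w l) \<inter> E = {}"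
      using nowhere_denseD[OF E, of k "\<lambda>i. if i < m then t i else y i"] by (elim exE conjE)
    have "z \<notin> E" if z: "\<exists>u\<in>insert t S. \<forall>i<m. z i = u i" "\<forall>i\<in>{m..<l}. z i = w i" for z
    proof (cases "\<exists>u\<in>S. \<forall>i<m. z i = u i")
      case True
      moreover have "\<forall>i\<in>{m..<k}. z i = y i"
      proof
        fix i assume i: "i \<in> {m..<k}"
        then have "w i = y i" using w(2) by auto
        moreover have "z i = w i" using z(2) w(1) i by auto
        ultimately show "z i = y i" by simp
      qed
      ultimately show ?thesis by (rule k(2))
    next
      case False
      then have t: "\<forall>i<m. z i = t i" using z(1) by auto
      have "z i = w i" if "i < l" for i
      proof (cases "i < m")
        case True
        then have "w i = t i" using w(2) k(1) by auto
        then show ?thesis using True t by simp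
      next
        case False
        then show ?thesis using z(2) that by auto
      qed
      then have "z \<in> cyl (pre w l)" by simp
      then show ?thesis using w(3) by blast
    qed
    then show ?case using k(1) w(1) by (intro exI[of _ l] exI[of _ w]) auto
  qed
  from this[OF \<open>finite T\<close>] obtain m' y where m': "m < m'"
    "\<And>z. \<lbrakk>\<exists>t\<in>T. \<forall>i<m. z i = t i; \<forall>i\<in>{m..<m'}. z i = y i\<rbrakk> \<Longrightarrow> z \<notin> E" by blast
  have "\<exists>t\<in>T. \<forall>i<m. z i = t i" for z
    by (rule bexI[of _ "\<lambda>i. i < m \<and> z i"]) (auto simp: T_def)
  then show ?thesis by (intro that[OF m'(1)] m'(2))
qed

text \<open>
  Let the \<open>n\<close>-th interval carry a block that keeps points out of the union of the first \<open>n + 1\<close>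
  nowhere dense sets. A point of one of them can then agree with \<open>y\<close> on finitely many intervals only.
\<close>

lemma meager_subset_avoid:
  assumes "meager A"
  obtains y a where "strict_mono a" "A \<subseteq> avoid y a"
proof -
  obtain F :: "nat \<Rightarrow> (nat \<Rightarrow> bool) set" where F: "\<And>n. nowhere_dense (F n)" "A = (\<Union>n. F n)"
    using assms unfolding meager_def by blast
  have "\<exists>m' y. m < m' \<and> (\<forall>z. (\<forall>i\<in>{m..<m'}. z i = y i) \<longrightarrow> z \<notin> (\<Union>k\<le>n. F k))" for m n
    using nowhere_dense_avoiding_block[OF nowhere_dense_UN_atMost[of F n, OF F(1)], of m] by metis
  then obtain M Y where M: "\<And>m n. m < M m n"
    "\<And>m n z. \<forall>i\<in>{m..<M m n}. z i = Y m n i \<Longrightarrow> z \<notin> (\<Union>k\<le>n. F k)"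
    by metis
  define a where "a = rec_nat 0 (\<lambda>n m. M m n)"
  have a: "a (Suc n) = M (a n) n" for n by (simp add: a_def)
  have sm: "strict_mono a" by (rule strict_monoI_Suc) (simp add: a M)
  obtain y where y: "\<And>n i. \<lbrakk>a n \<le> i; i < a (Suc n)\<rbrakk> \<Longrightarrow> y i = Y (a n) n i"
    using strict_mono_glue[OF sm, of "\<lambda>n. Y (a n) n"] by blast
  have "A \<subseteq> avoid y a"
  proof
    fix x assume "x \<in> A"
    then obtain k where k: "x \<in> F k" using F(2) by blast
    have "\<exists>i\<in>{a n..<a (Suc n)}. x i \<noteq> y i" if "k \<le> n" for n
    proof (rule ccontr)
      assume "\<not> ?thesis"
      then have "\<forall>i\<in>{a n..<M (a n) n}. x i = Y (a n) n i" using y by (auto simp: a)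
      then show False using M(2) k that by blast
    qed
    then show "x \<in> avoid y a" by (auto simp: avoid_def MOST_nat_le)
  qed
  then show ?thesis using that sm by blast
qed

text \<open>
  Otherwise some infinite set of intervals of \<open>c\<close> is bad, and after thinning out no two of them are
  adjacent. The point that copies \<open>z\<close> on the selected intervals and opposes \<open>y\<close> elsewhere is not in
  \<open>avoid z c\<close>. It is in \<open>avoid y a\<close>: an interval of \<open>a\<close> either reaches out of the selected set, where
  the point opposes \<open>y\<close>, or lies within one bad interval, where \<open>z\<close> and hence the point differ from
  \<open>y\<close> somewhere.
\<close>

lemma engulf:
  assumes a: "strict_mono a" and c: "strict_mono c" and sub: "avoid y a \<subseteq> avoid z c"
  shows "\<forall>\<^sub>\<infinity>n. \<exists>k. c n \<le> a k \<and> a (Suc k) \<le> c (Suc n) \<and> (\<forall>i\<in>{a k..<a (Suc k)}. y i = z i)"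
proof (rule ccontr)
  define bad where
    "bad = {n. \<not> (\<exists>k. c n \<le> a k \<and> a (Suc k) \<le> c (Suc n) \<and> (\<forall>i\<in>{a k..<a (Suc k)}. y i = z i))}"
  assume "\<not> ?thesis"
  then have "infinite bad" by (simp add: bad_def frequently_cofinite[symmetric])
  moreover have "bad = {n\<in>bad. even n} \<union> {n\<in>bad. odd n}" by auto
  ultimately have "infinite {n\<in>bad. even n} \<or> infinite {n\<in>bad. odd n}"
    by (metis finite_Un)
  \<comment> \<open>Thin out, so that two selected intervals are never adjacent.\<close>
  then obtain B where B: "infinite B" "B \<subseteq> bad" "\<And>n. n \<in> B \<Longrightarrow> Suc n \<notin> B"
  proof
    assume "infinite {n\<in>bad. even n}" then show thesis by (intro that) auto
  next
    assume "infinite {n\<in>bad. odd n}" then show thesis by (intro that) auto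
  qed
  define sel where "sel i \<longleftrightarrow> (\<exists>n\<in>B. c n \<le> i \<and> i < c (Suc n))" for i
  define x where "x i = (if sel i then z i else \<not> y i)" for i
  have "\<forall>n\<in>B. \<forall>i\<in>{c n..<c (Suc n)}. x i = z i" by (auto simp: x_def sel_def)
  then have "B \<subseteq> {n. \<forall>i\<in>{c n..<c (Suc n)}. x i = z i}" by blast
  then have "x \<notin> avoid z c"
    unfolding not_in_avoid frequently_cofinite using B(1) infinite_super by blast
  moreover have "x \<in> avoid y a"
  proof -
    have "\<exists>i\<in>{a k..<a (Suc k)}. x i \<noteq> y i" for k
    proof (rule ccontr)
      assume "\<not> ?thesis"
      then have eq: "x i = y i" if "a k \<le> i" "i < a (Suc k)" for i using that by auto
      then have s: "sel i" if "a k \<le> i" "i < a (Suc k)" for i using that by (metis x_def)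
      have "a k < a (Suc k)" using a by (simp add: strict_monoD)
      then obtain n where n: "n \<in> B" "c n \<le> a k" "a k < c (Suc n)" using s[of "a k"] sel_def by auto
      have "a (Suc k) \<le> c (Suc n)"
      proof (rule ccontr)
        assume "\<not> ?thesis"
        then obtain n' where n': "n' \<in> B" "c n' \<le> c (Suc n)" "c (Suc n) < c (Suc n')"
          using s[of "c (Suc n)"] n(3) sel_def by auto
        then have "n' = Suc n"
          using strict_mono_less_eq[OF c] strict_mono_less[OF c] by simp
        then show False using B(3) n(1) n'(1) by blast
      qed
      moreover have "\<forall>i\<in>{a k..<a (Suc k)}. y i = z i"
        using eq s by (metis atLeastLessThan_iff x_def)
      ultimately have "n \<notin> bad" using n(2) by (auto simp: bad_def)
      then show False using n(1) B(2) by blast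
    qed
    then show ?thesis by (simp add: avoid_def)
  qed
  ultimately show False using sub by blast
qed

text \<open>
  The Baire category theorem for the Cantor space: a point never lies in a set \<open>avoid y a\<close> built
  from that very point.
\<close>

lemma not_meager_UNIV: "\<not> meager (UNIV :: (nat \<Rightarrow> bool) set)"
proof
  assume "meager (UNIV :: (nat \<Rightarrow> bool) set)"
  then obtain y a where "UNIV \<subseteq> avoid y a" by (rule meager_subset_avoid)
  then have "y \<in> avoid y a" by blast
  then show False by (simp add: avoid_def)
qed

lemma closed_singleton_cantor: "closed {x :: nat \<Rightarrow> bool}"
proof -
  have "y = x" if "\<forall>m. y \<in> cyl (pre x m)" for y
  proof
    fix i show "y i = x i" using that[rule_format, of "Suc i"] unfolding in_cyl_pre by simp
  qed
  then have "{x} = (\<Inter>m. cyl (pre x m))" by auto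
  moreover have "closed (\<Inter>m. cyl (pre x m))" by (intro closed_INT ballI closed_cyl)
  ultimately show ?thesis by simp
qed

section \<open>Measure in the Cantor space\<close>

lemma product_prob_space_coin:
  "product_prob_space (\<lambda>_ :: nat. uniform_count_measure (UNIV :: bool set))"
proof -
  have "prob_space (uniform_count_measure (UNIV :: bool set))"
    by (rule prob_space_uniform_count_measure) auto
  then show ?thesis
    by (simp add: product_prob_space_def product_prob_space_axioms_def product_sigma_finite_def
        prob_space_imp_sigma_finite)
qed

interpretation cantor: prob_space cantor_measure
  unfolding cantor_measure_def
  by (rule prob_space_PiM) (rule prob_space_uniform_count_measure; simp)

lemma space_cantor [simp]: "space cantor_measure = UNIV"
  by (simp add: cantor_measure_def space_PiM PiE_UNIV_domain uniform_count_measure_def space_point_measure)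

text \<open>
  Finitely many coordinates are independent fair coins.
\<close>

lemma
  assumes "finite J"
  shows sets_finite_condition: "{x. \<forall>i\<in>J. x i = y i} \<in> sets cantor_measure"
    and measure_finite_condition: "measure cantor_measure {x. \<forall>i\<in>J. x i = y i} = (1/2) ^ card J"
proof -
  interpret C: product_prob_space "\<lambda>_ :: nat. uniform_count_measure (UNIV :: bool set)" UNIV
    by (rule product_prob_space_coin)
  have sp: "space (PiM UNIV (\<lambda>_ :: nat. uniform_count_measure (UNIV :: bool set))) = UNIV"
    using space_cantor by (simp add: cantor_measure_def)
  have "emeasure cantor_measure {x. \<forall>i\<in>J. x i = y i}
      = (\<Prod>i\<in>J. emeasure (uniform_count_measure (UNIV :: bool set)) {y i})"
    using C.emeasure_PiM_Collect[of J "\<lambda>i. {y i}"] assms sp by (simp add: cantor_measure_def)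
  also have "\<dots> = (\<Prod>i\<in>J. ennreal (1/2))"
    by (intro prod.cong) (simp_all add: emeasure_uniform_count_measure)
  also have "\<dots> = ennreal (\<Prod>i\<in>J. 1/2)" by (rule prod_ennreal) simp
  also have "\<dots> = ennreal ((1/2) ^ card J)" by (simp only: prod_constant)
  finally show "measure cantor_measure {x. \<forall>i\<in>J. x i = y i} = (1/2) ^ card J"
    by (simp add: measure_def)
  have "{x. x i = y i} \<in> sets cantor_measure" for i
  proof -
    have "(\<lambda>x. x i) \<in> measurable cantor_measure (uniform_count_measure (UNIV :: bool set))"
      unfolding cantor_measure_def by (rule measurable_component_singleton) simp
    from measurable_sets[OF this, of "{y i}"] show ?thesis
      by (simp add: vimage_def)
  qed
  then have "{x \<in> space cantor_measure. \<forall>i\<in>J. x i = y i} \<in> sets cantor_measure"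
    using assms by (intro sets.sets_Collect_finite_All) simp_all
  then show "{x. \<forall>i\<in>J. x i = y i} \<in> sets cantor_measure" by simp
qed

lemma cyl_eq: "cyl s = {x. \<forall>i\<in>{..<length s}. x i = s ! i}"
  by (auto simp: cyl_def)

lemma sets_cyl: "cyl s \<in> sets cantor_measure"
  unfolding cyl_eq by (rule sets_finite_condition) simp

lemma measure_cyl: "measure cantor_measure (cyl s) = (1/2) ^ length s"
  unfolding cyl_eq by (subst measure_finite_condition) auto

text \<open>
  The lower bound \<open>l\<close> on the lengths serves to build points by longer and longer initial segments.
\<close>

lemma open_eq_Union_cyl:
  assumes "open U"
  shows "U = (\<Union>s\<in>{s. cyl s \<subseteq> U \<and> l \<le> length s}. cyl s)"
proof
  show "U \<subseteq> (\<Union>s\<in>{s. cyl s \<subseteq> U \<and> l \<le> length s}. cyl s)"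
  proof
    fix x assume "x \<in> U"
    then obtain m where m: "cyl (pre x m) \<subseteq> U" using open_contains_cyl[OF assms] by blast
    have "cyl (pre x (max m l)) \<subseteq> cyl (pre x m)" by (simp add: subset_iff)
    then have "cyl (pre x (max m l)) \<subseteq> U" using m by (rule subset_trans)
    then show "x \<in> (\<Union>s\<in>{s. cyl s \<subseteq> U \<and> l \<le> length s}. cyl s)"
      by (intro UN_I[of "pre x (max m l)"]) simp_all
  qed
qed blast

lemma sets_open:
  assumes "open U"
  shows "U \<in> sets cantor_measure"
proof -
  have "(\<Union>s\<in>{s. cyl s \<subseteq> U \<and> 0 \<le> length s}. cyl s) \<in> sets cantor_measure"
    by (rule sets.countable_UN') (auto simp: sets_cyl)
  then show ?thesis using open_eq_Union_cyl[OF assms, of 0] by simp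
qed

lemma sets_closed:
  assumes "closed K"
  shows "K \<in> sets cantor_measure"
  using sets.compl_sets[OF sets_open[OF open_Compl[OF assms]]] by (simp add: Compl_eq_Diff_UNIV[symmetric])

lemma ideal_N_iff: "A \<in> ideal_N \<longleftrightarrow> (\<exists>N\<in>null_sets cantor_measure. A \<subseteq> N)"
  by (simp add: ideal_N_def null_sets_completion_iff2)

lemma null_sets_ideal_N: "N \<in> null_sets cantor_measure \<Longrightarrow> N \<in> ideal_N"
  by (auto simp: ideal_N_iff)

lemma ideal_N_subset: "\<lbrakk>B \<in> ideal_N; A \<subseteq> B\<rbrakk> \<Longrightarrow> A \<in> ideal_N"
  unfolding ideal_N_iff by blast

lemma ideal_N_countable_Union:
  assumes "countable J" "J \<subseteq> ideal_N"
  shows "\<Union>J \<in> ideal_N"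
  using assms null_sets_UN'[of J "\<lambda>A. A" "completion cantor_measure"] by (auto simp: ideal_N_def)

lemma measure_zero_ideal_N:
  assumes "A \<in> sets cantor_measure" "measure cantor_measure A = 0"
  shows "A \<in> ideal_N"
  using assms by (intro null_sets_ideal_N) (simp add: null_sets_def cantor.emeasure_eq_measure)

lemma ideal_N_singleton: "{x} \<in> ideal_N"
proof -
  have "closed {x}" by (rule closed_singleton_cantor)
  then have *: "{x} \<in> sets cantor_measure" by (rule sets_closed)
  have "measure cantor_measure {x} \<le> (1/2) ^ n" for n
    using cantor.finite_measure_mono[of "{x}" "cyl (pre x n)"] sets_cyl
    by (simp add: measure_cyl)
  moreover have "(\<lambda>n. (1/2 :: real) ^ n) \<longlonglongrightarrow> 0" by (rule LIMSEQ_realpow_zero) auto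
  ultimately have "measure cantor_measure {x} \<le> 0"
    by (intro LIMSEQ_le_const[of "\<lambda>n. (1/2 :: real) ^ n"]) auto
  then show ?thesis using * by (intro measure_zero_ideal_N) (simp_all add: order_antisym)
qed

lemma UNIV_not_ideal_N: "UNIV \<notin> ideal_N"
proof
  assume "UNIV \<in> ideal_N"
  then obtain N where "N \<in> null_sets cantor_measure" "UNIV \<subseteq> N" by (auto simp: ideal_N_iff)
  then have "UNIV \<in> null_sets cantor_measure" using top.extremum_uniqueI by blast
  then have "measure cantor_measure UNIV = 0" by (simp add: null_sets_def measure_def)
  then show False using cantor.prob_space by simp
qed

text \<open>
  The Borel-Cantelli lemma.
\<close>

lemma ideal_N_limsup:
  assumes "\<And>n. A n \<in> sets cantor_measure" "summable (\<lambda>n. measure cantor_measure (A n))"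
  shows "{x. \<exists>\<^sub>\<infinity>n. x \<in> A n} \<in> ideal_N"
proof (rule ideal_N_subset)
  show "limsup A \<in> ideal_N"
    by (rule null_sets_ideal_N, rule borel_cantelli_limsup1)
      (use assms in \<open>auto simp: cantor.emeasure_eq_measure\<close>)
  show "{x. \<exists>\<^sub>\<infinity>n. x \<in> A n} \<subseteq> limsup A"
    by (auto simp: limsup_INF_SUP INFM_nat_le)
qed

text \<open>
  Outer regularity holds for finite Borel measures on Polish spaces. The Cantor space inherits it
  from the image measure on the space of real sequences, along the embedding \<open>e\<close> with Borel left
  inverse \<open>r\<close>.
\<close>

lemma outer_regular_ideal_N:
  assumes "N \<in> ideal_N" "0 < \<epsilon>"
  obtains U where "open U" "N \<subseteq> U" "measure cantor_measure U < \<epsilon>"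
proof -
  obtain N' where N': "N' \<in> null_sets cantor_measure" "N \<subseteq> N'"
    using assms(1) unfolding ideal_N_iff by blast
  define e where "e x n = (of_bool (x n) :: real)" for x :: "nat \<Rightarrow> bool" and n :: nat
  define r where "r y n \<longleftrightarrow> (1/2 < y n)" for y :: "nat \<Rightarrow> real" and n :: nat
  have re: "r (e x) = x" for x by (rule ext) (auto simp: r_def e_def)
  have e_meas: "e \<in> measurable cantor_measure borel"
  proof -
    have "e \<in> measurable cantor_measure (PiM UNIV (\<lambda>_. borel))"
    proof (rule measurable_PiM_single')
      fix i :: nat
      have "(\<lambda>x. x i) \<in> measurable cantor_measure (uniform_count_measure (UNIV :: bool set))"
        unfolding cantor_measure_def by (rule measurable_component_singleton) simp
      moreover have "of_bool \<in> measurable (uniform_count_measure (UNIV :: bool set)) (borel :: real measure)"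
        by (simp add: measurable_def)
      ultimately have "(of_bool \<circ> (\<lambda>x. x i)) \<in> measurable cantor_measure (borel :: real measure)"
        by (rule measurable_comp)
      then show "(\<lambda>x. e x i) \<in> measurable cantor_measure borel" by (simp add: e_def comp_def)
    qed (simp add: PiE_UNIV_domain)
    then show ?thesis
      using measurable_cong_sets[OF refl sets_PiM_equal_borel, of cantor_measure] by blast
  qed
  have r_meas: "r \<in> measurable borel cantor_measure"
    unfolding cantor_measure_def
  proof (rule measurable_PiM_single')
    fix i :: nat
    have "(\<lambda>y :: nat \<Rightarrow> real. y i) \<in> borel_measurable borel"
      by (rule borel_measurable_continuous_onI) simp
    then have "Measurable.pred borel (\<lambda>y :: nat \<Rightarrow> real. 1/2 < y i)" by simp
    then show "(\<lambda>y. r y i) \<in> measurable borel (uniform_count_measure (UNIV :: bool set))"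
      by (simp add: r_def cong: measurable_cong_sets[OF refl sets_uniform_count_measure_count_space])
  qed (auto simp: uniform_count_measure_def space_point_measure)
  define M where "M = distr cantor_measure borel e"
  interpret M: prob_space M unfolding M_def by (rule cantor.prob_space_distr[OF e_meas])
  define B where "B = r -` N'"
  have B: "B \<in> sets borel"
    using measurable_sets[OF r_meas, of N'] N'(1) by (auto simp: B_def null_sets_def)
  have "emeasure M B = emeasure cantor_measure (e -` B)"
    unfolding M_def by (subst emeasure_distr[OF e_meas B]) simp
  also have "e -` B = N'" by (auto simp: B_def re)
  finally have "emeasure M B = 0" using N'(1) by (simp add: null_sets_def)
  moreover have "emeasure M B = (INF U \<in> {U. B \<subseteq> U \<and> open U}. emeasure M U)"
    by (rule outer_regular[OF _ _ B]) (simp add: M_def, simp add: M.emeasure_space_1)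
  ultimately have "(INF U \<in> {U. B \<subseteq> U \<and> open U}. emeasure M U) < ennreal \<epsilon>"
    using assms(2) by simp
  then obtain U where U: "B \<subseteq> U" "open U" "emeasure M U < ennreal \<epsilon>"
    unfolding Inf_less_iff by auto
  have "continuous_on UNIV e"
    unfolding e_def
  proof (rule continuous_on_coordinatewise_then_product)
    fix i :: nat
    have "continuous_on UNIV (of_bool :: bool \<Rightarrow> real)"
      by (simp add: continuous_on_open_vimage Topological_Spaces.open_discrete)
    then have "continuous_on UNIV (of_bool \<circ> (\<lambda>x :: nat \<Rightarrow> bool. x i) :: _ \<Rightarrow> real)"
      by (intro continuous_on_compose) (auto intro: continuous_on_subset)
    then show "continuous_on UNIV (\<lambda>x :: nat \<Rightarrow> bool. of_bool (x i) :: real)" by (simp add: comp_def)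
  qed
  then have op: "open (e -` U)" using U(2) by (rule open_vimage[rotated])
  have "emeasure cantor_measure (e -` U) < ennreal \<epsilon>"
    using U(2,3) emeasure_distr[OF e_meas, of U] by (simp add: M_def)
  then have "measure cantor_measure (e -` U) < \<epsilon>"
    using assms(2) by (simp add: cantor.emeasure_eq_measure ennreal_less_iff)
  moreover have "N \<subseteq> e -` U"
  proof
    fix x assume "x \<in> N"
    then have "e x \<in> B" using N'(2) by (auto simp: B_def re)
    then show "x \<in> e -` U" using U(1) by auto
  qed
  ultimately show ?thesis using that op by blast
qed

section \<open>The ideals of meager, null and F-sigma null sets\<close>

lemma ideal_M_iff: "A \<in> ideal_M \<longleftrightarrow> meager A"
  by (simp add: ideal_M_def)

lemma ideal_M_subset: "\<lbrakk>B \<in> ideal_M; A \<subseteq> B\<rbrakk> \<Longrightarrow> A \<in> ideal_M"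
  using meager_subset by (auto simp: ideal_M_iff)

lemma ideal_E_subset: "\<lbrakk>B \<in> ideal_E; A \<subseteq> B\<rbrakk> \<Longrightarrow> A \<in> ideal_E"
  unfolding ideal_E_def generated_ideal_def mem_Collect_eq using subset_trans by metis

text \<open>
  Every cylinder has positive measure.
\<close>

lemma open_null_empty:
  assumes "open U" "U \<in> ideal_N"
  shows "U = {}"
proof (rule ccontr)
  assume "U \<noteq> {}"
  then obtain x where "x \<in> U" by blast
  then obtain m where m: "cyl (pre x m) \<subseteq> U" using open_contains_cyl[OF assms(1)] by blast
  then obtain N where N: "N \<in> null_sets cantor_measure" "cyl (pre x m) \<subseteq> N"
    using assms(2) unfolding ideal_N_iff by blast
  then have "measure cantor_measure (cyl (pre x m)) \<le> measure cantor_measure N"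
    by (intro cantor.finite_measure_mono) auto
  also have "\<dots> = 0" using N(1) by (auto simp: null_sets_def measure_def)
  finally have "(1/2 :: real) ^ m \<le> 0" by (simp add: measure_cyl)
  moreover have "(0 :: real) < (1/2) ^ m" by simp
  ultimately show False by linarith
qed

text \<open>
  A closed null set has empty interior.
\<close>

lemma fsigma_null_meager:
  assumes "fsigma A" "A \<in> ideal_N"
  shows "meager A"
proof -
  obtain C :: "nat \<Rightarrow> (nat \<Rightarrow> bool) set" where C: "\<And>n. closed (C n)" "A = (\<Union>n. C n)"
    using assms(1) by (auto elim: fsigma.cases)
  have "nowhere_dense (C n)" for n
  proof -
    have "interior (C n) \<subseteq> A" using interior_subset C(2) by fast
    then have "interior (C n) \<in> ideal_N" by (rule ideal_N_subset[OF assms(2)])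
    then have "interior (C n) = {}" by (rule open_null_empty[OF open_interior])
    then show ?thesis using C(1) by (simp add: nowhere_dense_def)
  qed
  then show ?thesis using meagerI[of C A] C(2) by simp
qed

lemma ideal_E_subset_M: "ideal_E \<subseteq> ideal_M"
proof
  fix A assume "A \<in> ideal_E"
  then obtain H where H: "finite H" "H \<subseteq> {A. fsigma A \<and> A \<in> ideal_N}" "A \<subseteq> \<Union>H"
    unfolding ideal_E_def generated_ideal_def by blast
  from H(1,2) have "meager (\<Union>H)"
  proof (induction H)
    case empty
    show ?case by (rule meagerI[of "\<lambda>_. {}"]) (auto simp: nowhere_dense_def)
  next
    case (insert B H)
    then have "meager B" "meager (\<Union>H)" using fsigma_null_meager by simp_all
    then show ?case using meager_Un by simp
  qed
  then show "A \<in> ideal_M" using H(3) meager_subset by (auto simp: ideal_M_iff)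
qed

lemma ideal_E_subset_N: "ideal_E \<subseteq> ideal_N"
proof
  fix A assume "A \<in> ideal_E"
  then obtain H where H: "finite H" "H \<subseteq> {A. fsigma A \<and> A \<in> ideal_N}" "A \<subseteq> \<Union>H"
    unfolding ideal_E_def generated_ideal_def by blast
  then have "\<Union>H \<in> ideal_N" by (intro ideal_N_countable_Union countable_finite) auto
  then show "A \<in> ideal_N" using H(3) by (rule ideal_N_subset)
qed

lemma tukey_membership_mono:
  assumes "\<J> \<subseteq> \<I>"
  shows "tukey (membership_sys \<I>) (membership_sys \<J>)"
  by (rule tukeyI[of _ id _ id]) (use assms in auto)

text \<open>
  This connection compares additivity with covering number and uniformity with cofinality: a
  superset of \<open>A\<close> in the ideal misses some point, and that point lies outside \<open>A\<close>.
\<close>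

lemma tukey_nonmembership_inclusion:
  assumes "UNIV \<notin> \<I>"
  shows "tukey (dual (membership_sys \<I>)) (inclusion_sys \<I>)"
proof (rule tukeyI[of _ id _ "\<lambda>B. SOME x. x \<notin> B"])
  fix A B assume "A \<in> chal (dual (membership_sys \<I>))" "B \<in> resp (inclusion_sys \<I>)"
    "solves (inclusion_sys \<I>) (id A) B"
  then have "A \<subseteq> B" "B \<noteq> UNIV" using assms by auto
  then obtain x where "x \<notin> B" by blast
  then have "(SOME x. x \<notin> B) \<notin> B" by (rule someI)
  then show "solves (dual (membership_sys \<I>)) A (SOME x. x \<notin> B)"
    using \<open>A \<subseteq> B\<close> by (simp add: contra_subsetD)
qed auto

text \<open>
  Downward closure turns the four cardinal invariants into norms of relational systems; the other two
  conditions make these systems and their duals solvable.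
\<close>

definition proper_ideal :: "'a set set \<Rightarrow> bool" where
  "proper_ideal \<I> \<longleftrightarrow> (\<forall>B\<in>\<I>. \<forall>A. A \<subseteq> B \<longrightarrow> A \<in> \<I>) \<and> (\<forall>x. {x} \<in> \<I>) \<and> UNIV \<notin> \<I>"

lemma proper_ideal_norms:
  assumes "proper_ideal \<I>"
  shows "add \<I> = norm_of (dual (inclusion_sys \<I>))" "cof \<I> = norm_of (inclusion_sys \<I>)"
    "non \<I> = norm_of (dual (membership_sys \<I>))" "cov \<I> = norm_of (membership_sys \<I>)"
proof -
  have down: "A \<in> \<I>" if "B \<in> \<I>" "A \<subseteq> B" for A B using assms that unfolding proper_ideal_def by metis
  show "add \<I> = norm_of (dual (inclusion_sys \<I>))" by (rule add_eq_norm) (rule down)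
  show "non \<I> = norm_of (dual (membership_sys \<I>))" by (rule non_eq_norm) (rule down)
qed (rule cof_eq_norm cov_eq_norm)+

lemma proper_ideal_solvable:
  assumes "proper_ideal \<I>"
  shows "solvable (inclusion_sys \<I>)" "solvable (dual (inclusion_sys \<I>))"
    "solvable (membership_sys \<I>)" "solvable (dual (membership_sys \<I>))"
proof -
  have single: "{x} \<in> \<I>" for x using assms by (simp add: proper_ideal_def)
  have out: "\<exists>x. x \<notin> B" if "B \<in> \<I>" for B
    using assms that unfolding proper_ideal_def by (metis UNIV_eq_I)
  show "solvable (inclusion_sys \<I>)" by (auto simp: solvable_def)
  show "solvable (dual (membership_sys \<I>))" using out by (simp add: solvable_def)
  show "solvable (dual (inclusion_sys \<I>))"
    unfolding solvable_def dual_simps sys_simps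
  proof
    fix B assume "B \<in> \<I>"
    then obtain x where "x \<notin> B" using out by blast
    then show "\<exists>A\<in>\<I>. \<not> A \<subseteq> B" by (intro bexI[of _ "{x}"] single) simp
  qed
  show "solvable (membership_sys \<I>)"
    unfolding solvable_def sys_simps using single by blast
qed

lemma proper_ideal_add_le_cov:
  assumes "proper_ideal \<I>"
  shows "add \<I> \<le>o cov \<I>" "non \<I> \<le>o cof \<I>"
proof -
  have t: "tukey (dual (membership_sys \<I>)) (inclusion_sys \<I>)"
    by (rule tukey_nonmembership_inclusion) (use assms in \<open>simp add: proper_ideal_def\<close>)
  show "non \<I> \<le>o cof \<I>"
    unfolding proper_ideal_norms[OF assms] by (rule tukey_norm_le[OF t proper_ideal_solvable(1)[OF assms]])
  show "add \<I> \<le>o cov \<I>"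
    unfolding proper_ideal_norms[OF assms]
    using tukey_norm_le[OF tukey_dual[OF t]] proper_ideal_solvable(3)[OF assms] by simp
qed

lemma ideal_E_singleton: "{x} \<in> ideal_E"
proof -
  have "fsigma {x}" using fsigma.intros[of "\<lambda>_. {x}"] closed_singleton_cantor by simp
  then show ?thesis
    unfolding ideal_E_def generated_ideal_def
    by (intro CollectI exI[of _ "{{x}}"]) (simp add: ideal_N_singleton)
qed

lemma proper_ideal_N: "proper_ideal ideal_N"
  unfolding proper_ideal_def using ideal_N_subset ideal_N_singleton UNIV_not_ideal_N by metis

lemma proper_ideal_M: "proper_ideal ideal_M"
  unfolding proper_ideal_def
  using ideal_M_subset subsetD[OF ideal_E_subset_M ideal_E_singleton] not_meager_UNIV ideal_M_iff by metis

lemma proper_ideal_E: "proper_ideal ideal_E"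
  unfolding proper_ideal_def
  using ideal_E_subset ideal_E_singleton UNIV_not_ideal_N ideal_E_subset_N by (metis subsetD)

section \<open>Connections with the meager ideal\<close>

lemma strict_mono_square: "strict_mono (\<lambda>n :: nat. n\<^sup>2)"
  by (rule strict_monoI_Suc) (simp add: power2_eq_square)

text \<open>
  The \<open>n\<close>-th interval between consecutive squares has length \<open>2 * n + 1\<close>, so a point matches \<open>y\<close> on it
  with summable probability.
\<close>

lemma avoid_square_conull: "- avoid y (\<lambda>n. n\<^sup>2) \<in> ideal_N"
proof -
  define A where "A n = {x. \<forall>i\<in>{n\<^sup>2..<(Suc n)\<^sup>2}. x i = y i}" for n
  have "{x. \<exists>\<^sub>\<infinity>n. x \<in> A n} \<in> ideal_N"
  proof (rule ideal_N_limsup)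
    show "A n \<in> sets cantor_measure" for n unfolding A_def by (rule sets_finite_condition) simp
    have m: "measure cantor_measure (A n) = (1/2) ^ (2 * n + 1)" for n
    proof -
      have "card {n\<^sup>2..<(Suc n)\<^sup>2} = 2 * n + 1" by (simp add: power2_eq_square)
      then show ?thesis using measure_finite_condition[of "{n\<^sup>2..<(Suc n)\<^sup>2}" y] by (simp add: A_def)
    qed
    show "summable (\<lambda>n. measure cantor_measure (A n))"
    proof (rule summable_comparison_test')
      show "summable (\<lambda>n. (1/2 :: real) ^ n)" by (rule summable_geometric) simp
      show "norm (measure cantor_measure (A n)) \<le> (1/2) ^ n" for n
        unfolding m by (simp add: power_decreasing del: power_Suc)
    qed
  qed
  moreover have "- avoid y (\<lambda>n. n\<^sup>2) = {x. \<exists>\<^sub>\<infinity>n. x \<in> A n}"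
    using not_in_avoid[of _ y "\<lambda>n. n\<^sup>2"] by (auto simp: A_def)
  ultimately show ?thesis by simp
qed

text \<open>
  Rothberger's theorem. The relation of matching on infinitely many intervals between squares is
  symmetric, and for each \<open>y\<close> the set of points that match \<open>y\<close> is null while its complement is meager.
\<close>

lemma tukey_rothberger: "tukey (membership_sys ideal_N) (dual (membership_sys ideal_M))"
proof (rule tukeyI[of _ "\<lambda>x. avoid x (\<lambda>n. n\<^sup>2)" _ "\<lambda>y. - avoid y (\<lambda>n. n\<^sup>2)"])
  fix x show "avoid x (\<lambda>n. n\<^sup>2) \<in> chal (dual (membership_sys ideal_M))"
    using meager_avoid[OF strict_mono_square] by (simp add: ideal_M_iff)
next
  fix x y :: "nat \<Rightarrow> bool"
  assume "solves (dual (membership_sys ideal_M)) (avoid x (\<lambda>n. n\<^sup>2)) y"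
  then have "\<exists>\<^sub>\<infinity>n. \<forall>i\<in>{n\<^sup>2..<(Suc n)\<^sup>2}. y i = x i" using not_in_avoid[of y x "\<lambda>n. n\<^sup>2"] by simp
  then have "\<exists>\<^sub>\<infinity>n. \<forall>i\<in>{n\<^sup>2..<(Suc n)\<^sup>2}. x i = y i" by (simp add: eq_commute)
  then show "solves (membership_sys ideal_N) x (- avoid y (\<lambda>n. n\<^sup>2))"
    using not_in_avoid[of x y "\<lambda>n. n\<^sup>2"] by simp
qed (simp add: avoid_square_conull)

text \<open>
  A uniform choice of codes, so that the maps of the connections below are functions of the meager
  set.
\<close>

lemma meager_code: "\<exists>Y C. \<forall>B\<in>ideal_M. strict_mono (C B) \<and> B \<subseteq> avoid (Y B) (C B)"
proof -
  have "\<forall>B\<in>ideal_M. \<exists>y c. strict_mono c \<and> B \<subseteq> avoid y c"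
    using meager_subset_avoid by (metis ideal_M_iff)
  then show ?thesis by metis
qed

text \<open>
  Let each interval of \<open>a f\<close> be longer than all values of \<open>f\<close> up to its left end. If \<open>[c n, c (n + 1))\<close>
  contains an interval of \<open>a f\<close>, the left end of that interval is at least \<open>n\<close>, so \<open>f n\<close> is at most
  \<open>c (n + 1)\<close>.
\<close>

lemma tukey_dominating_meager: "tukey dominating_sys (inclusion_sys ideal_M)"
proof -
  obtain Y C where C: "\<And>B. B \<in> ideal_M \<Longrightarrow> strict_mono (C B)"
    "\<And>B. B \<in> ideal_M \<Longrightarrow> B \<subseteq> avoid (Y B) (C B)"
    using meager_code by metis
  define a where "a f = rec_nat 0 (\<lambda>_ k. k + 1 + (\<Sum>i\<le>k. f i))" for f :: "nat \<Rightarrow> nat"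
  have a: "a f (Suc k) = a f k + 1 + (\<Sum>i\<le>a f k. f i)" for f k by (simp add: a_def)
  have sm: "strict_mono (a f)" for f by (rule strict_monoI_Suc) (simp add: a)
  show ?thesis
  proof (rule tukeyI[of _ "\<lambda>f. avoid (\<lambda>_. False) (a f)" _ "\<lambda>B n. C B (Suc n)"])
    fix f show "avoid (\<lambda>_. False) (a f) \<in> chal (inclusion_sys ideal_M)"
      using meager_avoid[OF sm] by (simp add: ideal_M_iff)
  next
    fix f B assume B: "B \<in> resp (inclusion_sys ideal_M)"
      and sub: "solves (inclusion_sys ideal_M) (avoid (\<lambda>_. False) (a f)) B"
    have sC: "strict_mono (C B)" and "avoid (\<lambda>_. False) (a f) \<subseteq> avoid (Y B) (C B)"
      using B sub C by auto
    from engulf[OF sm this]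
    have "\<forall>\<^sub>\<infinity>n. f n \<le> C B (Suc n)"
    proof (rule MOST_mono)
      fix n assume "\<exists>k. C B n \<le> a f k \<and> a f (Suc k) \<le> C B (Suc n) \<and>
        (\<forall>i\<in>{a f k..<a f (Suc k)}. False = Y B i)"
      then obtain k where k: "C B n \<le> a f k" "a f (Suc k) \<le> C B (Suc n)" by blast
      have "n \<le> a f k" using strict_mono_imp_increasing[OF sC, of n] k(1) by simp
      then have "f n \<le> (\<Sum>i\<le>a f k. f i)" using member_le_sum[of n "{..a f k}" f] by simp
      then show "f n \<le> C B (Suc n)" using k(2) a[of f k] by simp
    qed
    then show "solves dominating_sys f (\<lambda>n. C B (Suc n))" by (simp add: le_star_def)
  qed simp
qed

text \<open>
  The distance to the next \<open>True\<close> can be made larger than any prescribed bound at an arbitrarily late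
  position, so the points whose gap function is dominated by \<open>g\<close> form a meager set.
\<close>

lemma tukey_meager_dominating: "tukey (membership_sys ideal_M) dominating_sys"
proof -
  define gap where "gap x n = (LEAST i. (x :: nat \<Rightarrow> bool) (n + i))" for x n
  have meager: "meager {x. gap x \<le>\<^sup>* g}" for g
  proof (rule meagerI)
    define F where "F m = {x. \<forall>n\<ge>m. gap x n \<le> g n}" for m
    show "{x. gap x \<le>\<^sup>* g} \<subseteq> (\<Union>m. F m)" by (auto simp: F_def le_star_def MOST_nat_le)
    fix m show "nowhere_dense (F m)"
      unfolding nowhere_dense_iff_cyl
    proof (intro allI)
      fix x M
      define n where "n = max m M"
      define y where "y i = (if i < n then x i else n + g n < i)" for i
      have "z \<notin> F m" if z: "\<forall>i<n + g n + 2. z i = y i" for z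
      proof -
        have "gap z n = Suc (g n)"
          unfolding gap_def
        proof (rule Least_equality)
          show "z (n + Suc (g n))" using z by (simp add: y_def)
          fix i assume "z (n + i)"
          then show "Suc (g n) \<le> i" using z[rule_format, of "n + i"] by (cases "i < Suc (Suc (g n))") (simp_all add: y_def)
        qed
        then have "\<not> gap z n \<le> g n" by simp
        moreover have "m \<le> n" by (simp add: n_def)
        ultimately show ?thesis unfolding F_def by blast
      qed
      then have "cyl (pre y (n + g n + 2)) \<inter> F m = {}" by (simp add: disjoint_iff del: upt_Suc)
      moreover have "M \<le> n + g n + 2" "y \<in> cyl (pre x M)" by (auto simp: n_def y_def)
      ultimately show "\<exists>y m'. M \<le> m' \<and> y \<in> cyl (pre x M) \<and> cyl (pre y m') \<inter> F m = {}" by blast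
    qed
  qed
  show ?thesis
    by (rule tukeyI[of _ gap _ "\<lambda>g. {x. gap x \<le>\<^sup>* g}"]) (simp_all add: meager ideal_M_iff)
qed

lemma strict_mono_interval:
  fixes c :: "nat \<Rightarrow> nat"
  assumes "strict_mono c" "c 0 = 0"
  shows "\<exists>n. c n \<le> i \<and> i < c (Suc n)"
proof (induction i)
  case 0
  then show ?case using assms by (intro exI[of _ 0]) (auto dest: strict_monoD[of c 0 1])
next
  case (Suc i)
  then obtain n where n: "c n \<le> i" "i < c (Suc n)" by blast
  show ?case
  proof (cases "Suc i < c (Suc n)")
    case True
    then show ?thesis using n by (intro exI[of _ n]) simp
  next
    case False
    then have "Suc i = c (Suc n)" using n by simp
    then show ?thesis using strict_monoD[OF assms(1), of "Suc n" "Suc (Suc n)"]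
      by (intro exI[of _ "Suc n"]) simp
  qed
qed

lemma interval_partition_strict_mono:
  fixes c :: "nat \<Rightarrow> nat"
  assumes c: "strict_mono c" "c 0 = 0"
  shows "(\<lambda>n. {c n..<c (Suc n)}) \<in> interval_partitions"
proof -
  have "\<exists>l u. l \<le> u \<and> {c n..<c (Suc n)} = {l..u}" for n
    using strict_monoD[OF c(1), of n "Suc n"]
    by (intro exI[of _ "c n"] exI[of _ "c (Suc n) - 1"]) auto
  moreover have "(\<Union>n. {c n..<c (Suc n)}) = UNIV"
    using strict_mono_interval[OF c] by auto
  moreover have "i < j" if "m < n" "i \<in> {c m..<c (Suc m)}" "j \<in> {c n..<c (Suc n)}" for m n i j
  proof -
    have "c (Suc m) \<le> c n" using that(1) strict_mono_less_eq[OF c(1)] by (simp add: Suc_le_eq)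
    then show ?thesis using that(2,3) by simp
  qed
  ultimately show ?thesis unfolding interval_partitions_def by blast
qed

lemma strict_mono_interval_unique:
  fixes a :: "nat \<Rightarrow> nat"
  assumes "strict_mono a" "a k \<le> i" "i < a (Suc k)" "a l \<le> i" "i < a (Suc l)"
  shows "k = l"
proof -
  have "a k < a (Suc l)" "a l < a (Suc k)" using assms(2-5) by simp_all
  then show ?thesis using strict_mono_less[OF assms(1)] by simp
qed

text \<open>
  The value \<open>f k < b k\<close> is coded in unary on the interval \<open>[s k, s (k + 1))\<close> of length \<open>b k\<close>, as the
  position of the only \<open>True\<close> there. A meager set \<open>avoid y c\<close> that contains \<open>avoid (e f) s\<close> forces
  \<open>y\<close> to agree with the code of \<open>f\<close> on one of these intervals within almost every interval of \<open>c\<close>, so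
  that the value \<open>h k\<close> decoded from \<open>y\<close> equals \<open>f k\<close>. It remains to choose a partition of the indices
  \<open>k\<close> so coarse that each part covers the codes within one interval of \<open>c\<close>.
\<close>

lemma tukey_meeting_meager:
  assumes b: "\<And>n. 0 < b n"
  shows "tukey (meeting_sys b) (inclusion_sys ideal_M)"
proof -
  obtain Y C where C: "\<And>B. B \<in> ideal_M \<Longrightarrow> strict_mono (C B)"
    "\<And>B. B \<in> ideal_M \<Longrightarrow> B \<subseteq> avoid (Y B) (C B)"
    using meager_code by metis
  define s where "s k = (\<Sum>j<k. b j)" for k
  have s: "strict_mono s" by (rule strict_monoI_Suc) (simp add: s_def b)
  have s_Suc: "s (Suc k) = s k + b k" for k by (simp add: s_def)
  define e where "e f i \<longleftrightarrow> (\<exists>k. i = s k + f k)" for f i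
  define h where "h B k = (if \<exists>v<b k. Y B (s k + v) then LEAST v. Y B (s k + v) else 0)" for B k
  \<comment> \<open>The \<open>m\<close>-th part of the partition covers the codes inside the interval of \<open>C B\<close> with index \<open>s (c B m)\<close>.\<close>
  define c where "c B = rec_nat 0 (\<lambda>_ k. if B \<in> ideal_M then C B (Suc (s k)) else Suc k)" for B
  have c_Suc: "c B (Suc m) = C B (Suc (s (c B m)))" if "B \<in> ideal_M" for B m
    using that by (simp add: c_def)
  have c: "strict_mono (c B)" if "B \<in> ideal_M" for B
  proof (rule strict_monoI_Suc)
    fix m
    have "c B m \<le> s (c B m)" by (rule strict_mono_imp_increasing[OF s])
    also have "\<dots> < Suc (s (c B m))" by simp
    also have "\<dots> \<le> C B (Suc (s (c B m)))" by (rule strict_mono_imp_increasing[OF C(1)[OF that]])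
    finally show "c B m < c B (Suc m)" using c_Suc that by simp
  qed
  have c0: "c B 0 = 0" for B by (simp add: c_def)
  show ?thesis
  proof (rule tukeyI[of _ "\<lambda>f. avoid (e f) s" _ "\<lambda>B. (\<lambda>n. {c B n..<c B (Suc n)}, h B)"])
    fix f show "avoid (e f) s \<in> chal (inclusion_sys ideal_M)"
      using meager_avoid[OF s] by (simp add: ideal_M_iff)
  next
    fix B assume B: "B \<in> resp (inclusion_sys ideal_M)"
    have "h B k < b k" for k
    proof (cases "\<exists>v<b k. Y B (s k + v)")
      case True
      then obtain v where v: "v < b k" "Y B (s k + v)" by blast
      then have "(LEAST v. Y B (s k + v)) \<le> v" by (intro Least_le)
      then show ?thesis using v True by (simp add: h_def)
    next
      case False
      then show ?thesis unfolding h_def by (simp only: if_False b)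
    qed
    then show "(\<lambda>n. {c B n..<c B (Suc n)}, h B) \<in> resp (meeting_sys b)"
      using interval_partition_strict_mono[OF c c0] B by (simp add: bprod_def)
  next
    fix f B assume f: "f \<in> chal (meeting_sys b)" and B': "B \<in> resp (inclusion_sys ideal_M)"
      and "solves (inclusion_sys ideal_M) (avoid (e f) s) B"
    then have B: "B \<in> ideal_M" and "avoid (e f) s \<subseteq> avoid (Y B) (C B)" using C by auto
    from engulf[OF s C(1)[OF B] this(2)] obtain N where
      N: "\<forall>n\<ge>N. \<exists>k. C B n \<le> s k \<and> s (Suc k) \<le> C B (Suc n) \<and> (\<forall>i\<in>{s k..<s (Suc k)}. e f i = Y B i)"
      unfolding MOST_nat_le by blast
    have fb: "f k < b k" for k using f by (auto simp: bprod_def)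
    have "\<exists>k\<in>{c B m..<c B (Suc m)}. f k = h B k" if "N \<le> m" for m
    proof -
      \<comment> \<open>The part with index \<open>m\<close> was chosen to contain all codes within this interval of \<open>C B\<close>.\<close>
      define n where "n = s (c B m)"
      have "m \<le> c B m" by (rule strict_mono_imp_increasing[OF c[OF B]])
      also have "\<dots> \<le> n" unfolding n_def by (rule strict_mono_imp_increasing[OF s])
      finally have "N \<le> n" using that by simp
      then obtain k where k: "C B n \<le> s k" "s (Suc k) \<le> C B (Suc n)"
        "\<forall>i\<in>{s k..<s (Suc k)}. e f i = Y B i" using N by blast
      have "s (c B m) \<le> s k" using k(1) strict_mono_imp_increasing[OF C(1)[OF B], of n] n_def by simp
      then have "c B m \<le> k" using strict_mono_less_eq[OF s] by simp
      moreover have "k < c B (Suc m)"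
        using k(2) strict_mono_imp_increasing[OF s, of "Suc k"] by (simp add: c_Suc[OF B] n_def)
      moreover have "h B k = f k"
      proof -
        have e: "e f (s k + v) \<longleftrightarrow> v = f k" if v: "v < b k" for v
        proof
          assume "e f (s k + v)"
          then obtain l where l: "s k + v = s l + f l" by (auto simp: e_def)
          have "k = l"
            by (rule strict_mono_interval_unique[OF s, of _ "s k + v"])
              (use v l fb[of l] in \<open>simp_all add: s_Suc\<close>)
          then show "v = f k" using l by simp
        qed (auto simp: e_def)
        have Yv: "Y B (s k + v) \<longleftrightarrow> v = f k" if "v < b k" for v
          using k(3) e[OF that] that by (simp add: s_Suc)
        then have "\<exists>v<b k. Y B (s k + v)" using fb[of k] by blast
        moreover have "(LEAST v. Y B (s k + v)) = f k"
        proof (rule Least_equality)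
          show "Y B (s k + f k)" using Yv fb by simp
          fix v assume "Y B (s k + v)"
          then show "f k \<le> v" using Yv[of v] fb[of k] by (cases "v < b k") auto
        qed
        ultimately show ?thesis by (simp add: h_def)
      qed
      ultimately show ?thesis by (intro bexI[of _ k]) simp_all
    qed
    then show "solves (meeting_sys b) f (\<lambda>n. {c B n..<c B (Suc n)}, h B)"
      by (simp only: sys_simps meets_def MOST_nat_le prod.case) blast
  qed
qed

section \<open>Meeting a function on intervals is an F-sigma null condition\<close>

lemma interval_partition_le:
  assumes "I \<in> interval_partitions" "j \<in> I n"
  shows "n \<le> j"
  using assms(2)
proof (induction n arbitrary: j)
  case (Suc n)
  obtain l u where "l \<le> u" "I n = {l..u}"
    using assms(1) unfolding interval_partitions_def mem_Collect_eq by metis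
  then have i: "l \<in> I n" by simp
  have "l < j" using assms(1) i Suc.prems lessI unfolding interval_partitions_def mem_Collect_eq by metis
  then show ?case using Suc.IH[OF i] by simp
qed simp

text \<open>
  The value at \<open>n\<close> is decided by the first \<open>L n\<close> coordinates, where \<open>2 ^ L n \<le> b n < 2 * 2 ^ L n\<close>, through
  an injection of their possible patterns into \<open>{..<b n}\<close>. The values at different places are far
  from independent, but only the union bound over one interval is used: if \<open>\<phi> x\<close> meets \<open>h\<close> on all
  intervals from \<open>m\<close> on, then the sum of \<open>2 / b k\<close> over an arbitrarily late interval bounds the
  probability.
\<close>

lemma tukey_E_meeting:
  assumes b: "\<And>n. 0 < b n" and sum: "summable (\<lambda>n. 1 / real (b n))"
  shows "tukey (membership_sys ideal_E) (meeting_sys b)"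
proof -
  have "\<exists>l e. b n < 2 * 2 ^ l \<and> inj_on e (Pow {..<l}) \<and> e ` Pow {..<l} \<subseteq> {..<b n}" for n
  proof -
    obtain l where l: "2 ^ l \<le> b n" "b n < 2 ^ (l + 1)"
      using ex_power_ivl1[of 2 "b n"] b[of n] by (auto simp: Suc_le_eq)
    have "card (Pow {..<l}) \<le> card {..<b n}" using l(1) by (simp add: card_Pow)
    then obtain e where "inj_on e (Pow {..<l})" "e ` Pow {..<l} \<subseteq> {..<b n}"
      using card_le_inj[of "Pow {..<l}" "{..<b n}"] by auto
    then show ?thesis using l(2) by auto
  qed
  then obtain L e where L: "\<And>n. b n < 2 * 2 ^ L n"
    and e: "\<And>n. inj_on (e n) (Pow {..<L n})" "\<And>n. e n ` Pow {..<L n} \<subseteq> {..<b n}"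
    by metis
  define \<phi> where "\<phi> x n = e n {i. i < L n \<and> x i}" for x n
  define D where "D v n = {x. \<phi> x n = v}" for v n
  have D_cases: "D v n = {} \<or> (\<exists>s. length s = L n \<and> D v n = cyl s)" for v n
  proof (cases "D v n = {}")
    case False
    then obtain x where x: "\<phi> x n = v" by (auto simp: D_def)
    have "\<phi> z n = v \<longleftrightarrow> (\<forall>i<L n. z i = x i)" for z
    proof -
      have "\<phi> z n = v \<longleftrightarrow> {i. i < L n \<and> z i} = {i. i < L n \<and> x i}"
        unfolding x[symmetric] \<phi>_def by (rule inj_on_eq_iff[OF e(1)]) auto
      then show ?thesis by (auto simp: set_eq_iff)
    qed
    then have "D v n = cyl (pre x (L n))" unfolding D_def set_eq_iff in_cyl_pre mem_Collect_eq by blast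
    then show ?thesis by (intro disjI2 exI[of _ "pre x (L n)"]) simp
  qed simp
  have D_closed: "closed (D v n)" for v n
    using D_cases[of v n] closed_cyl closed_empty by metis
  have D_measure: "measure cantor_measure (D v n) \<le> 2 * (1 / real (b n))" for v n
  proof -
    have "measure cantor_measure (D v n) \<le> (1/2) ^ L n"
      using D_cases[of v n]
    proof
      assume "D v n = {}"
      then show ?thesis by simp
    next
      assume "\<exists>s. length s = L n \<and> D v n = cyl s"
      then show ?thesis using measure_cyl by (metis order_refl)
    qed
    also have "\<dots> = 1 / 2 ^ L n" by (simp add: power_one_over)
    also have "\<dots> \<le> 2 * (1 / real (b n))"
    proof -
      have "real (b n) \<le> real (2 * 2 ^ L n)" unfolding of_nat_le_iff using L[of n] by (rule less_imp_le)
      then show ?thesis using b[of n] by (simp add: field_simps)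
    qed
    finally show ?thesis .
  qed
  have E: "{x. \<phi> x \<sqsubset>\<^sup>\<bullet> (I, h)} \<in> ideal_E" if I: "I \<in> interval_partitions" for I h
  proof -
    define K where "K m = (\<Inter>n\<in>{m..}. \<Union>k\<in>I n. D (h k) k)" for m
    have fin: "\<exists>l u. l \<le> u \<and> I n = {l..u}" for n
      using I by (simp add: interval_partitions_def)
    have finI: "finite (I n)" for n using fin[of n] by auto
    have K_closed: "closed (K m)" for m
      unfolding K_def by (intro closed_INT closed_UN ballI D_closed finI)
    have K_null: "K m \<in> ideal_N" for m
    proof (rule measure_zero_ideal_N)
      show "K m \<in> sets cantor_measure" by (rule sets_closed[OF K_closed])
      have "measure cantor_measure (K m) \<le> 0 + \<epsilon>" if "\<epsilon> > 0" for \<epsilon>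
      proof -
        obtain N where N: "\<And>l u. l \<ge> N \<Longrightarrow> norm (\<Sum>k\<in>{l..<u}. 1 / real (b k)) < \<epsilon> / 2"
          using sum \<open>\<epsilon> > 0\<close> unfolding summable_Cauchy by (metis half_gt_zero)
        define n where "n = max m N"
        obtain l u where lu: "l \<le> u" "I n = {l..<Suc u}" using fin[of n] by (auto simp: atLeastLessThanSuc_atLeastAtMost)
        have "n \<le> l" using interval_partition_le[OF I, of l n] lu by auto
        have "measure cantor_measure (K m) \<le> measure cantor_measure (\<Union>k\<in>I n. D (h k) k)"
        proof (rule cantor.finite_measure_mono)
          show "K m \<subseteq> (\<Union>k\<in>I n. D (h k) k)" unfolding K_def n_def by (rule INT_lower) simp
          show "(\<Union>k\<in>I n. D (h k) k) \<in> sets cantor_measure"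
            by (intro sets.finite_UN finI sets_closed D_closed)
        qed
        also have "\<dots> \<le> (\<Sum>k\<in>I n. measure cantor_measure (D (h k) k))"
          by (rule cantor.finite_measure_subadditive_finite[OF finI]) (auto intro: sets_closed D_closed)
        also have "\<dots> \<le> (\<Sum>k\<in>I n. 2 * (1 / real (b k)))"
          by (rule sum_mono) (rule D_measure)
        also have "\<dots> = 2 * (\<Sum>k\<in>{l..<Suc u}. 1 / real (b k))"
          unfolding lu(2) by (rule sum_distrib_left[symmetric])
        also have "\<dots> \<le> \<epsilon>" using N[of l "Suc u"] \<open>n \<le> l\<close> by (simp add: n_def)
        finally show ?thesis by simp
      qed
      then have "measure cantor_measure (K m) \<le> 0" by (rule field_le_epsilon)
      then show "measure cantor_measure (K m) = 0" by (simp add: order_antisym)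
    qed
    have eq: "{x. \<phi> x \<sqsubset>\<^sup>\<bullet> (I, h)} = (\<Union>m. K m)"
    proof -
      have "x \<in> K m \<longleftrightarrow> (\<forall>n\<ge>m. \<exists>k\<in>I n. \<phi> x k = h k)" for x m
        unfolding K_def D_def INT_iff UN_iff mem_Collect_eq Ball_def atLeast_iff ..
      then show ?thesis by (simp add: set_eq_iff meets_def MOST_nat_le)
    qed
    have "fsigma (\<Union>m. K m)" by (rule fsigma.intros) (rule K_closed)
    moreover have "(\<Union>m. K m) \<in> ideal_N"
      by (rule ideal_N_countable_Union) (auto simp: K_null)
    ultimately show ?thesis
      unfolding ideal_E_def generated_ideal_def eq by (intro CollectI exI[of _ "{\<Union>m. K m}"]) simp
  qed
  show ?thesis
  proof (rule tukeyI[of _ \<phi> _ "\<lambda>Ih. {x. \<phi> x \<sqsubset>\<^sup>\<bullet> Ih}"])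
    fix x
    have "\<phi> x n \<in> {..<b n}" for n
      by (rule subsetD[OF e(2)], unfold \<phi>_def, rule imageI) auto
    then show "\<phi> x \<in> chal (meeting_sys b)" by (simp add: bprod_def)
  next
    fix Ih assume "Ih \<in> resp (meeting_sys b)"
    then show "{x. \<phi> x \<sqsubset>\<^sup>\<bullet> Ih} \<in> resp (membership_sys ideal_E)" using E by (cases Ih) simp
  qed simp
qed

section \<open>Null sets localize functions\<close>

text \<open>
  For fixed \<open>n\<close> the sets \<open>block_coords n m\<close> are disjoint and have \<open>n\<close> elements, so the events
  \<open>block_event n m\<close> are independent of probability \<open>1 / 2 ^ n\<close>.
\<close>

definition block_coords :: "nat \<Rightarrow> nat \<Rightarrow> nat set" where
  "block_coords n m = (\<lambda>i. prod_encode (m, i)) ` {..<n}"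

definition block_event :: "nat \<Rightarrow> nat \<Rightarrow> (nat \<Rightarrow> bool) set" where
  "block_event n m = {x. \<forall>i\<in>block_coords n m. x i = True}"

lemma finite_block_coords [simp]: "finite (block_coords n m)"
  by (simp add: block_coords_def)

lemma card_block_coords: "card (block_coords n m) = n"
  unfolding block_coords_def by (subst card_image) (auto simp: inj_on_def)

lemma block_coords_disjoint: "m \<noteq> m' \<Longrightarrow> block_coords n m \<inter> block_coords n m' = {}"
  by (auto simp: block_coords_def)

lemma sets_block_event: "block_event n m \<in> sets cantor_measure"
  unfolding block_event_def by (rule sets_finite_condition) simp

lemma measure_block_event: "measure cantor_measure (block_event n m) = (1/2) ^ n"
  unfolding block_event_def by (subst measure_finite_condition) (simp_all add: card_block_coords)

lemma open_block_event: "open (block_event n m)"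
proof -
  have "open {f :: nat \<Rightarrow> bool. \<forall>i\<in>block_coords n m. f i \<in> {True}}"
    by (rule product_topology_basis') (simp, rule Topological_Spaces.open_discrete)
  then show ?thesis by (simp add: block_event_def)
qed

text \<open>
  Independence of the block events and of coordinates outside the blocks, by inclusion and exclusion:
  the points at which the last block event occurs are again described by a coordinate condition.
\<close>

lemma measure_block_events_fail:
  assumes "finite T" "finite J" "\<And>m. m \<in> T \<Longrightarrow> J \<inter> block_coords n m = {}"
  shows "measure cantor_measure ({x. \<forall>i\<in>J. x i = True} - (\<Union>m\<in>T. block_event n m))
    = (1/2) ^ card J * (1 - (1/2) ^ n) ^ card T"
  using assms
proof (induction T arbitrary: J)
  case empty
  then show ?case using measure_finite_condition[of J "\<lambda>_. True"] by simp
next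
  case (insert m T)
  define A where "A J = {x. \<forall>i\<in>J. x i = True} - (\<Union>m\<in>T. block_event n m)" for J
  have A_sets: "A J \<in> sets cantor_measure" if "finite J" for J
    unfolding A_def
    by (intro sets.Diff sets_finite_condition sets.finite_UN that insert.hyps(1) sets_block_event)
  have disj: "J \<inter> block_coords n m = {}" using insert.prems(2) by blast
  have IH1: "measure cantor_measure (A J) = (1/2) ^ card J * (1 - (1/2) ^ n) ^ card T"
    unfolding A_def by (rule insert.IH) (use insert.prems in auto)
  have IH2: "measure cantor_measure (A (J \<union> block_coords n m)) =
      (1/2) ^ (card J + n) * (1 - (1/2) ^ n) ^ card T"
  proof -
    have "measure cantor_measure (A (J \<union> block_coords n m)) =
        (1/2) ^ card (J \<union> block_coords n m) * (1 - (1/2) ^ n) ^ card T"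
      unfolding A_def
    proof (rule insert.IH)
      fix m' assume "m' \<in> T"
      then have "m' \<noteq> m" "J \<inter> block_coords n m' = {}" using insert.hyps(2) insert.prems(2) by auto
      then show "(J \<union> block_coords n m) \<inter> block_coords n m' = {}" using block_coords_disjoint[of m m' n] by blast
    qed (use insert.prems in simp)
    also have "card (J \<union> block_coords n m) = card J + n"
      using card_Un_disjoint[OF insert.prems(1) finite_block_coords disj] by (simp add: card_block_coords)
    finally show ?thesis .
  qed
  have eq: "{x. \<forall>i\<in>J. x i = True} - (\<Union>m\<in>insert m T. block_event n m) = A J - A (J \<union> block_coords n m)"
    unfolding A_def block_event_def by auto
  have "measure cantor_measure (A J - A (J \<union> block_coords n m)) =
      measure cantor_measure (A J) - measure cantor_measure (A (J \<union> block_coords n m))"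
  proof (rule cantor.finite_measure_Diff)
    show "A (J \<union> block_coords n m) \<subseteq> A J" unfolding A_def by blast
  qed (rule A_sets; simp add: insert.prems(1))+
  also have "\<dots> = (1/2) ^ card J * (1 - (1/2) ^ n) ^ card (insert m T)"
    unfolding IH1 IH2 using insert.hyps by (simp add: power_add algebra_simps)
  finally show ?case unfolding eq .
qed

text \<open>
  If \<open>K\<close> misses \<open>t\<close> of the independent events almost surely, then its measure is at most
  \<open>(1 - 1 / 2 ^ n) ^ t \<le> exp (- t / 2 ^ n)\<close>.
\<close>

lemma card_null_block_events:
  fixes n :: nat
  assumes K: "K \<in> sets cantor_measure" "0 < measure cantor_measure K"
    and C: "- ln (measure cantor_measure K) \<le> real C"
  defines "S \<equiv> {m. measure cantor_measure (K \<inter> block_event n m) = 0}"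
  shows "finite S \<and> card S \<le> C * 2 ^ n"
proof (rule finite_if_finite_subsets_card_bdd)
  fix T assume T: "T \<subseteq> S" "finite T"
  define p where "p = (1/2 :: real) ^ n"
  define U where "U = (\<Union>m\<in>T. block_event n m)"
  have U: "U \<in> sets cantor_measure" unfolding U_def by (intro sets.finite_UN T sets_block_event)
  have p: "0 < p" "p \<le> 1" by (simp_all add: p_def power_le_one)
  have "measure cantor_measure (K \<inter> U) \<le> (\<Sum>m\<in>T. measure cantor_measure (K \<inter> block_event n m))"
    unfolding U_def Int_UN_distrib
    by (rule cantor.finite_measure_subadditive_finite[OF T(2)]) (auto intro!: sets.Int K sets_block_event)
  also have "\<dots> = 0" by (rule sum.neutral) (use T in \<open>auto simp: S_def\<close>)
  finally have "measure cantor_measure (K \<inter> U) = 0" by (simp add: order_antisym)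
  then have "measure cantor_measure K = measure cantor_measure (K - U)"
    using cantor.finite_measure_Diff'[OF K(1) U] by simp
  also have "\<dots> \<le> measure cantor_measure ({x. \<forall>i\<in>{}. x i = True} - U)"
    using U sets.top[of cantor_measure] by (intro cantor.finite_measure_mono sets.Diff) auto
  also have "\<dots> = (1 - p) ^ card T"
    unfolding U_def p_def by (subst measure_block_events_fail) (use T in auto)
  also have "\<dots> \<le> exp (- p) ^ card T"
    by (rule power_mono) (use exp_ge_add_one_self[of "- p"] p in simp_all)
  also have "\<dots> = exp (- (card T * p))" by (simp add: exp_of_nat_mult[symmetric])
  finally have "ln (measure cantor_measure K) \<le> - (card T * p)"
    using K(2) by (metis exp_gt_zero ln_exp ln_le_cancel_iff)
  then have "card T * p \<le> C" using C by simp
  then have "real (card T) \<le> C * 2 ^ n" by (simp add: p_def power_one_over field_simps)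
  then have "real (card T) \<le> real (C * 2 ^ n)" by simp
  then show "card T \<le> C * 2 ^ n" by (simp only: of_nat_le_iff)
qed

text \<open>
  A Baire category argument in \<open>K\<close>, where cylinders that meet \<open>K\<close> in positive measure play the role
  of nonempty open sets: if the claim fails, one can descend through such cylinders into sets \<open>G n\<close>
  with larger and larger \<open>n\<close>, and the limit point is in \<open>K\<close> because \<open>K\<close> is closed.
\<close>

lemma baire_positive_measure:
  assumes K: "closed K" "0 < measure cantor_measure K"
    and G: "\<And>n :: nat. open (G n)" and avoid: "K \<inter> {x. \<exists>\<^sub>\<infinity>n. x \<in> G n} = {}"
  shows "\<exists>s k. 0 < measure cantor_measure (K \<inter> cyl s) \<and>
    (\<forall>n\<ge>k. measure cantor_measure (K \<inter> cyl s \<inter> G n) = 0)"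
proof (rule ccontr)
  assume contra: "\<not> ?thesis"
  define pos where "pos s \<longleftrightarrow> 0 < measure cantor_measure (K \<inter> cyl s)" for s
  have KS: "K \<in> sets cantor_measure" using K(1) by (rule sets_closed)
  have step: "\<exists>t. length s < length t \<and> cyl t \<subseteq> cyl s \<and> (\<exists>n\<ge>k. cyl t \<subseteq> G n) \<and> pos t"
    if s: "pos s" for s k
  proof -
    obtain n where n: "k \<le> n" "measure cantor_measure (K \<inter> cyl s \<inter> G n) \<noteq> 0"
      using contra s unfolding pos_def by metis
    define T where "T = {t. cyl t \<subseteq> cyl s \<inter> G n \<and> Suc (length s) \<le> length t}"
    have V: "cyl s \<inter> G n = (\<Union>t\<in>T. cyl t)"
      unfolding T_def by (rule open_eq_Union_cyl) (intro open_Int open_cyl G)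
    have "\<exists>t\<in>T. pos t"
    proof (rule ccontr)
      assume none: "\<not> ?thesis"
      have "K \<inter> cyl t \<in> null_sets cantor_measure" if "t \<in> T" for t
      proof -
        have "measure cantor_measure (K \<inter> cyl t) \<le> 0" using none that by (simp add: pos_def not_less)
        then have "measure cantor_measure (K \<inter> cyl t) = 0" by (simp add: order_antisym)
        then show ?thesis using sets.Int[OF KS sets_cyl] by (simp add: null_sets_def cantor.emeasure_eq_measure)
      qed
      then have "(\<Union>t\<in>T. K \<inter> cyl t) \<in> null_sets cantor_measure"
        by (intro null_sets_UN') simp_all
      moreover have "(\<Union>t\<in>T. K \<inter> cyl t) = K \<inter> cyl s \<inter> G n"
        unfolding Int_assoc V by (rule Int_UN_distrib[symmetric])
      ultimately show False using n(2) by (auto simp: null_sets_def measure_def)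
    qed
    then obtain t where t: "t \<in> T" "pos t" by blast
    then have "length s < length t" "cyl t \<subseteq> cyl s" "cyl t \<subseteq> G n" by (simp_all add: T_def)
    then show ?thesis using n(1) t(2) by blast
  qed
  then have "\<forall>s k. \<exists>t. pos s \<longrightarrow> length s < length t \<and> cyl t \<subseteq> cyl s \<and> (\<exists>n\<ge>k. cyl t \<subseteq> G n) \<and> pos t"
    by metis
  then obtain ext where nxt: "\<And>s k. pos s \<Longrightarrow> length s < length (ext s k)"
    "\<And>s k. pos s \<Longrightarrow> cyl (ext s k) \<subseteq> cyl s" "\<And>s k. pos s \<Longrightarrow> \<exists>n\<ge>k. cyl (ext s k) \<subseteq> G n"
    "\<And>s k. pos s \<Longrightarrow> pos (ext s k)"
    by metis
  define S where "S = rec_nat [] (\<lambda>j s. ext s j)"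
  have S_Suc: "S (Suc j) = ext (S j) j" for j by (simp add: S_def)
  have pos: "pos (S j)" for j
  proof (induction j)
    case 0
    have "cyl [] = UNIV" by (simp add: cyl_def)
    then show ?case using K(2) by (simp add: S_def pos_def)
  qed (simp add: S_Suc nxt(4))
  have len: "j \<le> length (S j)" for j
  proof (induction j)
    case (Suc j)
    then show ?case using nxt(1)[OF pos, of j j] by (simp add: S_Suc)
  qed simp
  have dec: "cyl (S j') \<subseteq> cyl (S j)" if "j \<le> j'" for j j'
    using that
  proof (induction rule: dec_induct)
    case (step i)
    then show ?case using nxt(2)[OF pos, of i i] by (simp add: S_Suc)
  qed simp
  \<comment> \<open>The limit of the nested cylinders.\<close>
  define x where "x i = S (Suc i) ! i" for i
  have compat: "S j' ! i = S j ! i" if "j \<le> j'" "i < length (S j)" "i < length (S j')" for i j j'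
  proof -
    define z where "z i = S j' ! i" for i
    have "z \<in> cyl (S j')" by (simp add: cyl_def z_def)
    then have "z \<in> cyl (S j)" using dec[OF that(1)] by blast
    then show ?thesis using that(2) by (simp add: cyl_def z_def)
  qed
  have x: "x \<in> cyl (S j)" for j
    unfolding cyl_def
  proof (intro CollectI allI impI)
    fix i assume i: "i < length (S j)"
    have i': "i < length (S (Suc i))" using len[of "Suc i"] by simp
    show "x i = S j ! i"
      unfolding x_def using compat[of j "Suc i" i] compat[of "Suc i" j i] i i' by (cases "j \<le> Suc i") simp_all
  qed
  have "x \<in> K"
  proof (rule ccontr)
    assume "x \<notin> K"
    then obtain m where m: "cyl (pre x m) \<subseteq> - K"
      using open_contains_cyl[of "- K" x] K(1) by (auto simp: open_Compl)
    have "cyl (S m) \<subseteq> cyl (pre x m)"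
    proof
      fix z assume z: "z \<in> cyl (S m)"
      have "z i = x i" if "i < m" for i
      proof -
        have "i < length (S m)" using that len[of m] by simp
        then show ?thesis using z x[of m] by (simp add: cyl_def)
      qed
      then show "z \<in> cyl (pre x m)" by simp
    qed
    then have "K \<inter> cyl (S m) = {}" using m by blast
    then show False using pos[of m] by (simp add: pos_def)
  qed
  moreover have "\<exists>\<^sub>\<infinity>n. x \<in> G n"
    unfolding INFM_nat_le
  proof
    fix k
    obtain n where "k \<le> n" "cyl (S (Suc k)) \<subseteq> G n" using nxt(3)[OF pos, of k k] S_Suc by auto
    then show "\<exists>n\<ge>k. x \<in> G n" using x by blast
  qed
  ultimately show False using avoid by blast
qed

text \<open>
  By independence of the block events, a null set that covers this one leaves only finitely many
  candidates for almost every value \<open>f n\<close>; see \<open>null_code_localization\<close>.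
\<close>

definition null_code :: "(nat \<Rightarrow> nat) \<Rightarrow> (nat \<Rightarrow> bool) set" where
  "null_code f = {x. \<exists>\<^sub>\<infinity>n. x \<in> block_event n (f n)}"

lemma null_code_null: "null_code f \<in> ideal_N"
  unfolding null_code_def
  by (rule ideal_N_limsup) (simp_all add: sets_block_event measure_block_event summable_geometric)

definition width :: "nat \<Rightarrow> nat" where
  "width n = Suc n * (n * 2 ^ n)"

text \<open>
  Let \<open>K\<close> be the complement of an open superset of \<open>N\<close> of measure below one. If \<open>null_code f \<subseteq> N\<close>, then
  within \<open>K\<close> and a suitable cylinder the events \<open>block_event n (f n)\<close> eventually have measure zero, and
  by independence only a bounded multiple of \<open>2 ^ n\<close> many values can take the place of \<open>f n\<close>. There are
  countably many cylinders; the set \<open>S n\<close> collects the values from those among the first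
  \<open>n + 1\<close> of them for which the multiple is at most \<open>n\<close>.
\<close>

lemma null_code_localization:
  assumes "N \<in> ideal_N"
  shows "\<exists>S. (\<forall>n. finite (S n) \<and> card (S n) \<le> width n) \<and>
    (\<forall>f. null_code f \<subseteq> N \<longrightarrow> (\<forall>\<^sub>\<infinity>n. f n \<in> S n))"
proof -
  obtain U where U: "open U" "N \<subseteq> U" "measure cantor_measure U < 1"
    by (rule outer_regular_ideal_N[OF assms zero_less_one])
  define K where "K = - U"
  have K: "closed K" using U(1) by (simp add: K_def closed_Compl)
  have Kpos: "0 < measure cantor_measure K"
    using cantor.prob_compl[OF sets_open[OF U(1)]] U(3) by (simp add: K_def Compl_eq_Diff_UNIV)
  define seq where "seq j = (from_nat j :: bool list)" for j
  define m where "m s = measure cantor_measure (K \<inter> cyl s)" for s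
  define R where "R j n = {i. measure cantor_measure (K \<inter> cyl (seq j) \<inter> block_event n i) = 0}" for j n
  define J where "J n = {j. j \<le> n \<and> 0 < m (seq j) \<and> - ln (m (seq j)) \<le> real n}" for n
  \<comment> \<open>At stage \<open>n\<close> only cylinders among the first \<open>n + 1\<close> contribute, each at most \<open>n * 2 ^ n\<close> values.\<close>
  define S where "S n = (\<Union>j\<in>J n. R j n)" for n
  have finJ: "finite (J n)" for n by (rule finite_subset[of _ "{..n}"]) (auto simp: J_def)
  have R: "finite (R j n) \<and> card (R j n) \<le> n * 2 ^ n" if "j \<in> J n" for j n
    unfolding R_def
  proof (rule card_null_block_events)
    show "K \<inter> cyl (seq j) \<in> sets cantor_measure" by (intro sets.Int sets_closed K sets_cyl)
  qed (use that in \<open>simp_all add: J_def m_def\<close>)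
  have "finite (S n) \<and> card (S n) \<le> width n" for n
  proof
    show "finite (S n)" unfolding S_def using finJ R by simp
    have "card (S n) \<le> (\<Sum>j\<in>J n. card (R j n))" unfolding S_def by (rule card_UN_le[OF finJ])
    also have "\<dots> \<le> (\<Sum>j\<in>J n. n * 2 ^ n)" by (rule sum_mono) (use R in blast)
    also have "\<dots> = card (J n) * (n * 2 ^ n)" by simp
    also have "\<dots> \<le> card {..n} * (n * 2 ^ n)"
      by (intro mult_right_mono card_mono) (auto simp: J_def)
    finally show "card (S n) \<le> width n" by (simp add: width_def)
  qed
  moreover have "\<forall>\<^sub>\<infinity>n. f n \<in> S n" if f: "null_code f \<subseteq> N" for f
  proof -
    have "K \<inter> {x. \<exists>\<^sub>\<infinity>n. x \<in> block_event n (f n)} = {}"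
      using f U(2) unfolding null_code_def K_def by blast
    from baire_positive_measure[OF K Kpos open_block_event this]
    obtain s k where s: "0 < m s"
      "\<And>n. k \<le> n \<Longrightarrow> measure cantor_measure (K \<inter> cyl s \<inter> block_event n (f n)) = 0"
      unfolding m_def by blast
    define j where "j = to_nat s"
    have j: "seq j = s" by (simp add: seq_def j_def)
    obtain C :: nat where C: "- ln (m s) \<le> real C" using real_arch_simple ..
    have "f n \<in> S n" if "max k (max j C) \<le> n" for n
    proof -
      have "j \<in> J n" using that s(1) C by (simp add: J_def j)
      moreover have "f n \<in> R j n" using that s(2) by (simp add: R_def j)
      ultimately show ?thesis unfolding S_def by blast
    qed
    then show ?thesis unfolding MOST_nat_le by blast
  qed
  ultimately show ?thesis by blast
qed

section \<open>Measure dominates category\<close>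

text \<open>
  The elements of \<open>S n\<close> code candidates for an initial segment. The windows \<open>[p j, p (j + 1))\<close> with
  \<open>q n \<le> j < q (n + 1)\<close> are so many that \<open>z\<close> can follow each candidate on a window of its own.
\<close>

lemma slalom_merge:
  fixes p q :: "nat \<Rightarrow> nat" and S :: "nat \<Rightarrow> nat set"
  assumes p: "strict_mono p" and q: "strict_mono q"
    and S: "\<And>n. finite (S n)" "\<And>n. card (S n) \<le> q (Suc n) - q n"
  shows "\<exists>z :: nat \<Rightarrow> bool. \<forall>n. \<forall>s\<in>S n. \<exists>j. q n \<le> j \<and> j < q (Suc n) \<and>
    (\<forall>i. p j \<le> i \<and> i < p (Suc j) \<longrightarrow> z i = (from_nat s :: bool list) ! i)"
proof -
  have "\<exists>e. S n = e ` {..<card (S n)}" for n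
    using ex_bij_betw_nat_finite[OF S(1), of n] by (metis bij_betw_def atLeast0LessThan)
  then obtain e where e: "\<And>n. S n = e n ` {..<card (S n)}" by metis
  obtain t where t: "\<And>n j. \<lbrakk>q n \<le> j; j < q (Suc n)\<rbrakk> \<Longrightarrow> t j = e n (j - q n)"
    using strict_mono_glue[OF q, of "\<lambda>n j. e n (j - q n)"] by metis
  obtain z where z: "\<And>j i. \<lbrakk>p j \<le> i; i < p (Suc j)\<rbrakk> \<Longrightarrow> z i = (from_nat (t j) :: bool list) ! i"
    using strict_mono_glue[OF p, of "\<lambda>j i. (from_nat (t j) :: bool list) ! i"] by metis
  have "\<exists>j. q n \<le> j \<and> j < q (Suc n) \<and>
    (\<forall>i. p j \<le> i \<and> i < p (Suc j) \<longrightarrow> z i = (from_nat s :: bool list) ! i)" if s: "s \<in> S n" for n s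
  proof -
    have "s \<in> e n ` {..<card (S n)}" using s e[of n] by metis
    then obtain v where v: "v < card (S n)" "s = e n v" by blast
    then have "q n + v < q (Suc n)" using S(2)[of n] by linarith
    then have "t (q n + v) = s" using t[of n "q n + v"] v(2) by simp
    then have "z i = (from_nat s :: bool list) ! i" if "p (q n + v) \<le> i \<and> i < p (Suc (q n + v))" for i
      using z[of "q n + v" i] that by simp
    then show ?thesis using \<open>q n + v < q (Suc n)\<close> by (intro exI[of _ "q n + v"]) simp
  qed
  then show ?thesis by metis
qed

text \<open>
  The first null set bounds the function \<open>\<lambda>n. C B (n + 1)\<close>. It thereby yields windows
  \<open>[p j, p (j + 1))\<close>, and almost all of them contain the interval of \<open>C B\<close> whose index is \<open>p j\<close>. The
  second null set localizes the initial segments of \<open>Y B\<close> up to the end of the \<open>n\<close>-th group of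
  windows. On some window of almost every group the merged point \<open>z\<close> agrees with \<open>Y B\<close>, so a point
  that matches \<open>z\<close> on infinitely many groups matches \<open>Y B\<close> on infinitely many intervals of \<open>C B\<close>.
\<close>

lemma meager_null_two_step:
  shows "norm_of (dual (inclusion_sys ideal_N)) \<le>o norm_of (dual (inclusion_sys ideal_M))"
    and "norm_of (inclusion_sys ideal_M) \<le>o norm_of (inclusion_sys ideal_N)"
proof -
  obtain Y C where C: "\<And>B. B \<in> ideal_M \<Longrightarrow> strict_mono (C B)"
    "\<And>B. B \<in> ideal_M \<Longrightarrow> B \<subseteq> avoid (Y B) (C B)"
    using meager_code by metis
  have "\<forall>N\<in>ideal_N. \<exists>S. (\<forall>n. finite (S n) \<and> card (S n) \<le> width n) \<and>
    (\<forall>f. null_code f \<subseteq> N \<longrightarrow> (\<forall>\<^sub>\<infinity>n. f n \<in> S n))"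
    using null_code_localization by blast
  then obtain S where "\<forall>N\<in>ideal_N. (\<forall>n. finite (S N n) \<and> card (S N n) \<le> width n) \<and>
    (\<forall>f. null_code f \<subseteq> N \<longrightarrow> (\<forall>\<^sub>\<infinity>n. f n \<in> S N n))"
    by (rule bchoice[THEN exE])
  then have S: "\<And>N n. N \<in> ideal_N \<Longrightarrow> finite (S N n)" "\<And>N n. N \<in> ideal_N \<Longrightarrow> card (S N n) \<le> width n"
    "\<And>N f. \<lbrakk>N \<in> ideal_N; null_code f \<subseteq> N\<rbrakk> \<Longrightarrow> \<forall>\<^sub>\<infinity>n. f n \<in> S N n"
    by simp_all
  \<comment> \<open>A bound of all elements of \<open>S N n\<close> that also makes \<open>p N\<close> strictly increasing.\<close>
  define g where "g N n = Suc n + (\<Sum>s\<in>S N n. s)" for N n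
  define p where "p N = rec_nat 0 (\<lambda>_ k. g N k)" for N
  have p_Suc: "p N (Suc j) = g N (p N j)" for N j by (simp add: p_def)
  have p: "strict_mono (p N)" for N by (rule strict_monoI_Suc) (simp add: p_Suc g_def)
  \<comment> \<open>The \<open>n\<close>-th group consists of the windows with indices in \<open>[q n, q (n + 1))\<close>.\<close>
  define q where "q n = (\<Sum>m<n. Suc (width m))" for n
  have q: "strict_mono q" by (rule strict_monoI_Suc) (simp add: q_def)
  have q_Suc: "q (Suc n) - q n = Suc (width n)" for n by (simp add: q_def)
  define c where "c N n = p N (q n)" for N n
  have c: "strict_mono (c N)" for N
    unfolding c_def by (intro strict_monoI) (simp add: strict_mono_less[OF p] strict_mono_less[OF q])
  define good where "good N N' z \<longleftrightarrow> (\<forall>n. \<forall>s\<in>S N' n. \<exists>j. q n \<le> j \<and> j < q (Suc n) \<and>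
    (\<forall>i. p N j \<le> i \<and> i < p N (Suc j) \<longrightarrow> z i = (from_nat s :: bool list) ! i))" for N N' z
  define z where "z N N' = (SOME z. good N N' z)" for N N'
  have "good N N' (z N N')" if N': "N' \<in> ideal_N" for N N'
  proof -
    have "card (S N' n) \<le> q (Suc n) - q n" for n using S(2)[OF N', of n] by (simp add: q_Suc)
    from slalom_merge[OF p q S(1)[OF N'] this] have "\<exists>z. good N N' z" unfolding good_def .
    then show ?thesis unfolding z_def by (rule someI_ex)
  qed
  then have z: "\<exists>j. q n \<le> j \<and> j < q (Suc n) \<and>
    (\<forall>i. p N j \<le> i \<and> i < p N (Suc j) \<longrightarrow> z N N' i = (from_nat s :: bool list) ! i)"
    if "N' \<in> ideal_N" "s \<in> S N' n" for N N' n s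
    using that unfolding good_def by metis
  define \<phi> where "\<phi> B = null_code (\<lambda>n. C B (Suc n))" for B
  define \<rho> where "\<rho> N B = null_code (\<lambda>n. to_nat (pre (Y B) (c N (Suc n))))" for N B
  have key: "B \<subseteq> avoid (z N N') (c N)"
    if B: "B \<in> ideal_M" and N: "N \<in> ideal_N" and N': "N' \<in> ideal_N"
      and sub: "\<phi> B \<subseteq> N" "\<rho> N B \<subseteq> N'" for B N N'
  proof -
    have "\<forall>\<^sub>\<infinity>n. C B (Suc n) \<in> S N n" by (rule S(3)[OF N sub(1)[unfolded \<phi>_def]])
    then obtain n1 where n1: "\<forall>n\<ge>n1. C B (Suc n) \<in> S N n" unfolding MOST_nat_le ..
    have "\<forall>\<^sub>\<infinity>n. to_nat (pre (Y B) (c N (Suc n))) \<in> S N' n"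
      by (rule S(3)[OF N' sub(2)[unfolded \<rho>_def]])
    then obtain n2 where n2: "\<forall>n\<ge>n2. to_nat (pre (Y B) (c N (Suc n))) \<in> S N' n"
      unfolding MOST_nat_le ..
    have "x \<notin> avoid (Y B) (C B)" if x: "x \<notin> avoid (z N N') (c N)" for x
      unfolding not_in_avoid INFM_nat_le
    proof
      fix m
      obtain n where n: "max m (max n1 n2) \<le> n" "\<forall>i\<in>{c N n..<c N (Suc n)}. x i = z N N' i"
        using x unfolding not_in_avoid INFM_nat_le by metis
      have "to_nat (pre (Y B) (c N (Suc n))) \<in> S N' n" by (rule n2[rule_format]) (use n(1) in simp)
      from z[OF N' this, of N] obtain j where j: "q n \<le> j" "j < q (Suc n)"
        "\<forall>i. p N j \<le> i \<and> i < p N (Suc j) \<longrightarrow>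
          z N N' i = (from_nat (to_nat (pre (Y B) (c N (Suc n)))) :: bool list) ! i"
        by (elim exE conjE)
      \<comment> \<open>The interval of \<open>C B\<close> with index \<open>p N j\<close> lies inside the window that starts at \<open>p N j\<close>.\<close>
      define k where "k = p N j"
      have "n \<le> q n" by (rule strict_mono_imp_increasing[OF q])
      then have "n \<le> j" using j(1) by simp
      also have "j \<le> k" unfolding k_def by (rule strict_mono_imp_increasing[OF p])
      finally have nk: "n \<le> k" .
      have "C B (Suc k) \<in> S N k" by (rule n1[rule_format]) (use n(1) nk in simp)
      then have "C B (Suc k) \<le> (\<Sum>s\<in>S N k. s)"
        using member_le_sum[of "C B (Suc k)" "S N k" "\<lambda>s. s"] S(1)[OF N] by simp
      then have hi: "C B (Suc k) \<le> p N (Suc j)" by (simp add: p_Suc g_def k_def[symmetric])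
      have lo: "k \<le> C B k" by (rule strict_mono_imp_increasing[OF C(1)[OF B]])
      have top: "p N (Suc j) \<le> c N (Suc n)" using j(2) strict_mono_less_eq[OF p] by (simp add: c_def Suc_le_eq)
      have bot: "c N n \<le> k" using j(1) strict_mono_less_eq[OF p] by (simp add: c_def k_def)
      have "\<forall>i\<in>{C B k..<C B (Suc k)}. x i = Y B i"
      proof
        fix i assume i: "i \<in> {C B k..<C B (Suc k)}"
        then have i2: "k \<le> i" "i < p N (Suc j)" using hi lo by simp_all
        then have "x i = z N N' i" using n(2) top bot by simp
        also have "\<dots> = pre (Y B) (c N (Suc n)) ! i"
          using j(3)[rule_format, of i] i2 by (simp only: k_def from_nat_to_nat simp_thms)
        also have "\<dots> = Y B i" using i2(2) top by simp
        finally show "x i = Y B i" .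
      qed
      moreover have "m \<le> k" using n(1) nk by simp
      ultimately show "\<exists>k\<ge>m. \<forall>i\<in>{C B k..<C B (Suc k)}. x i = Y B i" by blast
    qed
    then show ?thesis using C(2)[OF B] by blast
  qed
  note two_step = tukey_two_step[of "inclusion_sys ideal_M" \<phi> "inclusion_sys ideal_N" \<rho>
      "\<lambda>N N'. avoid (z N N') (c N)"]
  show "norm_of (dual (inclusion_sys ideal_N)) \<le>o norm_of (dual (inclusion_sys ideal_M))"
  proof (rule two_step(1))
    show "solvable (dual (inclusion_sys ideal_M))" by (rule proper_ideal_solvable(2)[OF proper_ideal_M])
  qed (simp_all add: \<phi>_def \<rho>_def null_code_null ideal_M_iff meager_avoid[OF c] key[unfolded ideal_M_iff \<phi>_def \<rho>_def])
  show "norm_of (inclusion_sys ideal_M) \<le>o norm_of (inclusion_sys ideal_N)"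
  proof (rule two_step(2))
    show "solvable (inclusion_sys ideal_N)" by (rule proper_ideal_solvable(1)[OF proper_ideal_N])
    fix D assume D: "D \<subseteq> resp (inclusion_sys ideal_N)"
      "\<forall>x\<in>chal (inclusion_sys ideal_N). \<exists>y\<in>D. solves (inclusion_sys ideal_N) x y"
    show "infinite D"
    proof
      assume "finite D"
      then have "\<Union>D \<in> ideal_N" using D(1) by (intro ideal_N_countable_Union countable_finite) simp_all
      then obtain x where "x \<notin> \<Union>D" using UNIV_not_ideal_N by (metis UNIV_eq_I)
      then show False using D(2) ideal_N_singleton[of x] by fastforce
    qed
  qed (simp_all add: \<phi>_def \<rho>_def null_code_null ideal_M_iff meager_avoid[OF c] key[unfolded ideal_M_iff \<phi>_def \<rho>_def])
qed

text \<open>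
  By outer regularity the null sets that are intersections of countably many open sets are cofinal,
  and such a set is coded by the list of basic cylinders inside each of the open sets.
\<close>

lemma cof_N_le_continuum: "cof ideal_N \<le>o continuum"
proof -
  define code where "code d = (\<Inter>n :: nat. \<Union>s\<in>{s. d (to_nat (n, s))}. cyl s)" for d :: "nat \<Rightarrow> bool"
  have "cof ideal_N \<le>o |code ` {d. code d \<in> ideal_N}|"
    unfolding cof_eq_norm
  proof (rule norm_of_le)
    fix A assume "A \<in> chal (inclusion_sys ideal_N)"
    then have A: "A \<in> ideal_N" by simp
    have "\<exists>U. open U \<and> A \<subseteq> U \<and> measure cantor_measure U < (1/2) ^ n" for n :: nat
      using outer_regular_ideal_N[OF A, of "(1/2) ^ n"] by (metis zero_less_power half_gt_zero zero_less_one)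
    then obtain U where U: "\<And>n. open (U n)" "\<And>n. A \<subseteq> U n"
      "\<And>n. measure cantor_measure (U n) < (1/2) ^ n" by metis
    define d where "d k \<longleftrightarrow> (case from_nat k of (n, s) \<Rightarrow> cyl s \<subseteq> U n)" for k
    have d: "d (to_nat (n, s)) \<longleftrightarrow> cyl s \<subseteq> U n" for n s by (simp add: d_def)
    have "(\<Union>s\<in>{s. d (to_nat (n, s))}. cyl s) = U n" for n
      using open_eq_Union_cyl[OF U(1), of n 0] by (simp add: d)
    then have code: "code d = (\<Inter>n. U n)" by (simp only: code_def)
    have "code d \<in> ideal_N"
    proof (rule measure_zero_ideal_N)
      show S: "code d \<in> sets cantor_measure"
        unfolding code by (intro sets.countable_INT) (auto intro: sets_open U)
      have "measure cantor_measure (code d) \<le> (1/2) ^ n" for n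
      proof -
        have "measure cantor_measure (code d) \<le> measure cantor_measure (U n)"
          by (rule cantor.finite_measure_mono) (auto simp: code intro: sets_open U)
        then show ?thesis using U(3)[of n] by simp
      qed
      moreover have "(\<lambda>n. (1/2 :: real) ^ n) \<longlonglongrightarrow> 0" by (rule LIMSEQ_realpow_zero) auto
      ultimately have "measure cantor_measure (code d) \<le> 0"
        by (intro LIMSEQ_le_const[of "\<lambda>n. (1/2 :: real) ^ n"]) auto
      then show "measure cantor_measure (code d) = 0" by (simp add: order_antisym)
    qed
    moreover have "A \<subseteq> code d" using U(2) by (auto simp: code)
    ultimately show "\<exists>y\<in>code ` {d. code d \<in> ideal_N}. solves (inclusion_sys ideal_N) A y"
      by (intro bexI[of _ "code d"]) simp_all
  qed auto
  also have "|code ` {d. code d \<in> ideal_N}| \<le>o |{d. code d \<in> ideal_N}|" by (rule card_of_image)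
  also have "|{d. code d \<in> ideal_N}| \<le>o |UNIV :: (nat \<Rightarrow> bool) set|" by (rule card_of_mono1) simp
  also have "|UNIV :: (nat \<Rightarrow> bool) set| = continuum"
    by (simp add: continuum_def cexp_def ctwo_def Field_natLeq Field_card_of Func_def)
  finally show ?thesis .
qed

text \<open>
  Countable unions of null sets are null.
\<close>

lemma aleph1_le_add_N: "aleph1 \<le>o add ideal_N"
proof -
  have "\<Union>ideal_N = UNIV" using ideal_N_singleton by blast
  then have "{\<J>. \<J> \<subseteq> ideal_N \<and> \<Union>\<J> \<notin> ideal_N} \<noteq> {}" using UNIV_not_ideal_N by auto
  from min_card_attained[OF this] obtain J where
    J: "J \<subseteq> ideal_N" "\<Union>J \<notin> ideal_N" "add ideal_N = |J|" by (auto simp: add_def)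
  have "\<not> countable J" using J(1,2) ideal_N_countable_Union by blast
  then have "\<not> |J| \<le>o |UNIV :: nat set|" by (auto simp: countable_def card_of_ordLeq[symmetric])
  then have "\<not> |J| \<le>o natLeq" using card_of_nat ordIso_symmetric ordLeq_ordIso_trans by blast
  then have "natLeq <o |J|" using not_ordLeq_iff_ordLess[OF natLeq_Well_order card_of_Well_order] by blast
  then show ?thesis
    unfolding aleph1_def J(3) by (intro cardSuc_least natLeq_Card_order card_of_Card_order)
qed

section \<open>The diagram\<close>

lemma solvable_dominating: "solvable dominating_sys" "solvable (dual dominating_sys)"
proof -
  have "f \<le>\<^sup>* f" for f by (simp add: le_star_def)
  then show "solvable dominating_sys" by (auto simp: solvable_def)
  have "\<not> (\<lambda>n. Suc (g n)) \<le>\<^sup>* g" for g by (simp add: le_star_def not_less_eq_eq[symmetric])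
  then show "solvable (dual dominating_sys)" by (auto simp: solvable_def)
qed

lemma solvable_meeting: "solvable (meeting_sys b)"
proof -
  have "(\<lambda>n. {n..<Suc n}) \<in> interval_partitions"
    using interval_partition_strict_mono[of "\<lambda>n. n"] by (simp add: strict_mono_def)
  moreover have "f \<sqsubset>\<^sup>\<bullet> (\<lambda>n. {n..<Suc n}, f)" for f by (simp add: meets_def)
  ultimately show ?thesis unfolding solvable_def sys_simps by blast
qed

lemma norm_of_unsolvable:
  assumes "\<not> solvable P"
  shows "norm_of P = |UNIV|"
proof -
  have "{D. D \<subseteq> resp P \<and> (\<forall>x\<in>chal P. \<exists>y\<in>D. solves P x y)} = {}"
    using assms unfolding solvable_def by blast
  then show ?thesis unfolding norm_of_def min_card_def by simp
qed

lemma add_M_le_bounding: "add ideal_M \<le>o bounding_number"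
  unfolding bounding_eq_norm proper_ideal_norms[OF proper_ideal_M]
  by (rule tukey_norm_le[OF tukey_dual[OF tukey_dominating_meager] solvable_dominating(2)])

text \<open>
  If a single pair \<open>(I, h)\<close> solves every \<open>f\<close>, as when \<open>b n = 1\<close> infinitely often, then \<open>b_eq b\<close> is by
  convention the size of the space of all functions, which bounds \<open>bounding_number\<close>.
\<close>

lemma add_M_le_b_eq:
  assumes "\<And>n. 0 < b n"
  shows "add ideal_M \<le>o b_eq b"
proof (cases "solvable (dual (meeting_sys b))")
  case True
  then show ?thesis
    unfolding b_eq_eq_norm proper_ideal_norms[OF proper_ideal_M]
    using tukey_norm_le[OF tukey_dual[OF tukey_meeting_meager[of b, OF assms]]] by blast
next
  case False
  then have "b_eq b = |UNIV|" unfolding b_eq_eq_norm by (rule norm_of_unsolvable)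
  moreover have "bounding_number \<le>o |UNIV :: (nat \<Rightarrow> nat) set|"
    unfolding bounding_number_def by (rule min_card_le_UNIV)
  ultimately show ?thesis using ordLeq_transitive[OF add_M_le_bounding] by simp
qed

lemma d_eq_le_cof_M:
  assumes "\<And>n. 0 < b n"
  shows "d_eq b \<le>o cof ideal_M"
  unfolding d_eq_eq_norm proper_ideal_norms[OF proper_ideal_M]
  by (rule tukey_norm_le[OF tukey_meeting_meager[of b, OF assms] proper_ideal_solvable(1)[OF proper_ideal_M]])

lemma
  assumes "\<And>n. 0 < b n" "summable (\<lambda>n. 1 / real (b n))"
  shows b_eq_le_non_E: "b_eq b \<le>o non ideal_E" and cov_E_le_d_eq: "cov ideal_E \<le>o d_eq b"
proof -
  have t: "tukey (membership_sys ideal_E) (meeting_sys b)" by (rule tukey_E_meeting[of b, OF assms])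
  show "cov ideal_E \<le>o d_eq b"
    unfolding d_eq_eq_norm proper_ideal_norms[OF proper_ideal_E] by (rule tukey_norm_le[OF t solvable_meeting])
  show "b_eq b \<le>o non ideal_E"
    unfolding b_eq_eq_norm proper_ideal_norms[OF proper_ideal_E]
    by (rule tukey_norm_le[OF tukey_dual[OF t] proper_ideal_solvable(4)[OF proper_ideal_E]])
qed

text \<open>
  Apply the bounds on \<open>b_eq b\<close> and \<open>d_eq b\<close> to \<open>b n = 2 ^ n\<close>, whose reciprocals are summable.
\<close>

lemma
  shows add_M_le_non_E: "add ideal_M \<le>o non ideal_E" and cov_E_le_cof_M: "cov ideal_E \<le>o cof ideal_M"
proof -
  define b where "b n = (2 :: nat) ^ n" for n
  have pos: "\<And>n. 0 < b n" by (simp add: b_def)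
  have "summable (\<lambda>n. (1/2 :: real) ^ n)" by (rule summable_geometric) simp
  then have sum: "summable (\<lambda>n. 1 / real (b n))" by (simp add: b_def power_one_over)
  show "add ideal_M \<le>o non ideal_E"
    by (rule ordLeq_transitive[OF add_M_le_b_eq[of b, OF pos] b_eq_le_non_E[of b, OF pos sum]])
  show "cov ideal_E \<le>o cof ideal_M"
    by (rule ordLeq_transitive[OF cov_E_le_d_eq[of b, OF pos sum] d_eq_le_cof_M[of b, OF pos]])
qed

lemma
  shows cov_N_le_non_M: "cov ideal_N \<le>o non ideal_M" and cov_M_le_non_N: "cov ideal_M \<le>o non ideal_N"
proof -
  show "cov ideal_N \<le>o non ideal_M"
    unfolding proper_ideal_norms[OF proper_ideal_N] proper_ideal_norms[OF proper_ideal_M]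
    by (rule tukey_norm_le[OF tukey_rothberger proper_ideal_solvable(4)[OF proper_ideal_M]])
  have "tukey (membership_sys ideal_M) (dual (membership_sys ideal_N))"
    using tukey_dual[OF tukey_rothberger] by simp
  then show "cov ideal_M \<le>o non ideal_N"
    unfolding proper_ideal_norms[OF proper_ideal_N] proper_ideal_norms[OF proper_ideal_M]
    by (rule tukey_norm_le[OF _ proper_ideal_solvable(4)[OF proper_ideal_N]])
qed

lemma
  shows bounding_le_non_M: "bounding_number \<le>o non ideal_M"
    and cov_M_le_dominating: "cov ideal_M \<le>o dominating_number"
  unfolding bounding_eq_norm dominating_eq_norm proper_ideal_norms[OF proper_ideal_M]
  by (rule tukey_norm_le[OF tukey_dual[OF tukey_meager_dominating] proper_ideal_solvable(4)[OF proper_ideal_M]],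
      rule tukey_norm_le[OF tukey_meager_dominating solvable_dominating(1)])

lemma dominating_le_cof_M: "dominating_number \<le>o cof ideal_M"
  unfolding dominating_eq_norm proper_ideal_norms[OF proper_ideal_M]
  by (rule tukey_norm_le[OF tukey_dominating_meager proper_ideal_solvable(1)[OF proper_ideal_M]])

lemma non_cov_antimono:
  assumes "proper_ideal \<I>" "proper_ideal \<J>" "\<J> \<subseteq> \<I>"
  shows "non \<J> \<le>o non \<I>" "cov \<I> \<le>o cov \<J>"
proof -
  have t: "tukey (membership_sys \<I>) (membership_sys \<J>)" by (rule tukey_membership_mono[OF assms(3)])
  show "cov \<I> \<le>o cov \<J>"
    unfolding proper_ideal_norms[OF assms(1)] proper_ideal_norms[OF assms(2)]
    by (rule tukey_norm_le[OF t proper_ideal_solvable(3)[OF assms(2)]])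
  show "non \<J> \<le>o non \<I>"
    unfolding proper_ideal_norms[OF assms(1)] proper_ideal_norms[OF assms(2)]
    by (rule tukey_norm_le[OF tukey_dual[OF t] proper_ideal_solvable(4)[OF assms(1)]])
qed

lemma
  shows add_N_le_add_M: "add ideal_N \<le>o add ideal_M" and cof_M_le_cof_N: "cof ideal_M \<le>o cof ideal_N"
  unfolding proper_ideal_norms[OF proper_ideal_N] proper_ideal_norms[OF proper_ideal_M]
  by (rule meager_null_two_step)+

theorem theoremA:
  fixes b :: "nat \<Rightarrow> nat"
  assumes b_pos: "\<And>n. 0 < b n"
  shows
    "(add ideal_M \<le>o b_eq b \<and>
      (summable (\<lambda>n. 1 / real (b n)) \<longrightarrow> b_eq b \<le>o non ideal_E) \<and>
      (summable (\<lambda>n. 1 / real (b n)) \<longrightarrow> cov ideal_E \<le>o d_eq b) \<and>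
      d_eq b \<le>o cof ideal_M)
     \<and>
     (aleph1 \<le>o add ideal_N \<and> add ideal_N \<le>o cov ideal_N \<and> cov ideal_N \<le>o non ideal_M \<and>
      non ideal_M \<le>o cof ideal_M \<and> cof ideal_M \<le>o cof ideal_N \<and> cof ideal_N \<le>o continuum \<and>

      add ideal_N \<le>o add ideal_M \<and> add ideal_M \<le>o cov ideal_M \<and> cov ideal_M \<le>o non ideal_N \<and>
      non ideal_N \<le>o cof ideal_N \<and>

      add ideal_M \<le>o bounding_number \<and> bounding_number \<le>o non ideal_M \<and>
      cov ideal_M \<le>o dominating_number \<and> dominating_number \<le>o cof ideal_M \<and>
      bounding_number \<le>o dominating_number \<and>

      add ideal_M \<le>o non ideal_E \<and> non ideal_E \<le>o non ideal_M \<and>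
      non ideal_E \<le>o non ideal_N \<and> non ideal_E \<le>o cof ideal_M \<and>

      add ideal_M \<le>o cov ideal_E \<and> cov ideal_M \<le>o cov ideal_E \<and>
      cov ideal_N \<le>o cov ideal_E \<and> cov ideal_E \<le>o cof ideal_M)"
proof -
  note M = proper_ideal_add_le_cov[OF proper_ideal_M] and N = proper_ideal_add_le_cov[OF proper_ideal_N]
  note EM = non_cov_antimono[OF proper_ideal_M proper_ideal_E ideal_E_subset_M]
  note EN = non_cov_antimono[OF proper_ideal_N proper_ideal_E ideal_E_subset_N]
  have "non ideal_E \<le>o cof ideal_M" by (rule ordLeq_transitive[OF EM(1) M(2)])
  moreover have "add ideal_M \<le>o cov ideal_E" by (rule ordLeq_transitive[OF M(1) EM(2)])
  ultimately show ?thesis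
    by (intro conjI impI add_M_le_b_eq b_eq_le_non_E cov_E_le_d_eq d_eq_le_cof_M b_pos
        aleph1_le_add_N M N cov_N_le_non_M cof_M_le_cof_N cof_N_le_continuum add_N_le_add_M cov_M_le_non_N
        add_M_le_bounding bounding_le_non_M cov_M_le_dominating dominating_le_cof_M bounding_le_dominating
        add_M_le_non_E EM EN cov_E_le_cof_M)
qed

end
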